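(* Let $T$ be a tree of diameter $4$ and let $c_t$ be its unique central vertex. Then $$\operatorname{con}(T\overline{T})=\begin{cases} n(T)+\Delta(T)-1, & \text{if } \deg_T(c_t)<\Delta(T),\\ \max\{\,n(T)+\Delta(T\setminus\{c_t\})-1,\; 2\Delta(T)+1,\; n(T)+2e(c_t)-\Delta(T)+1\,\}, & \text{otherwise.}\end{cases}$$
   Context: For a graph $G$ with complement $\overline{G}$, the complementary prism $G\overline{G}$ is the graph obtained from the disjoint union of $G$ and $\overline{G}$ by adding the perfect matching joining each vertex $v$ of $G$ to its copy $\overline{v}$ in $\overline{G}$. For a graph $H$, a set $S\subseteq V(H)$ is (geodesically) convex if every vertex on every shortest path between two vertices of $S$ belongs to $S$. The convexity number $\operatorname{con}(H)$ is the maximum cardinality of a proper (i.e. $\neq V(H)$) convex set of $H$. The central vertices are those of minimum eccentricity. $n(T)=|V(T)|$, $\Delta(T)$ is the maximum degree of $T$, $\Delta(T\setminus\{c_t\})=\max\{\deg_T(y): y\in V(T)\setminus\{c_t\}\}$ (degrees taken in $T$), and $e(x)$ denotes the number of pendant (degree-one) neighbors of $x$ in $T$. *)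

theory Defs
  imports "Graph_Theory.Graph_Theory"
begin

text \<open>
  A finite simple undirected graph is rendered as a \<^locale>\<open>pair_graph\<close>: a finite, loop-free,
  symmetric digraph whose arcs are pairs of vertices. Each undirected edge is a pair of opposite
  arcs, so the degree of a vertex is its \<^const>\<open>out_degree\<close>.
\<close>

text \<open>
  The library predicate \<^const>\<open>tree\<close> is not usable here: as a directed notion it counts
  the closed walk along an arc and back as a cycle. In a \<^locale>\<open>pair_graph\<close>, the directed cycles
  of length at least 3 are exactly the traversals of cycles of the undirected graph.
\<close>

definition undirected_tree :: "'a pair_pre_digraph \<Rightarrow> bool" where
  "undirected_tree T \<longleftrightarrow> pair_graph T \<and> connected (with_proj T) \<and>
     \<not> (\<exists>p. pre_digraph.cycle (with_proj T) p \<and> length p \<ge> 3)"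

text \<open>The hop distance, which is \<open>\<infinity>\<close> between different components.\<close>

definition hop_dist :: "('a, 'b) pre_digraph \<Rightarrow> 'a \<Rightarrow> 'a \<Rightarrow> ereal" where
  "hop_dist G u v = wf_digraph.\<mu> G (\<lambda>_. 1) u v"

definition eccentricity :: "('a, 'b) pre_digraph \<Rightarrow> 'a \<Rightarrow> ereal" where
  "eccentricity G u = (SUP v \<in> verts G. hop_dist G u v)"

definition graph_diameter :: "('a, 'b) pre_digraph \<Rightarrow> ereal" where
  "graph_diameter G = (SUP u \<in> verts G. eccentricity G u)"

definition central_verts :: "('a, 'b) pre_digraph \<Rightarrow> 'a set" where
  "central_verts G = {c \<in> verts G. \<forall>u \<in> verts G. eccentricity G c \<le> eccentricity G u}"

definition shortest_path :: "('a, 'b) pre_digraph \<Rightarrow> 'a \<Rightarrow> 'b awalk \<Rightarrow> 'a \<Rightarrow> bool" where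
  "shortest_path G u p v \<longleftrightarrow> pre_digraph.apath G u p v \<and> ereal (real (length p)) = hop_dist G u v"

definition geodesically_convex :: "('a, 'b) pre_digraph \<Rightarrow> 'a set \<Rightarrow> bool" where
  "geodesically_convex G S \<longleftrightarrow> S \<subseteq> verts G \<and>
     (\<forall>u \<in> S. \<forall>v \<in> S. \<forall>p. shortest_path G u p v \<longrightarrow> set (pre_digraph.awalk_verts G u p) \<subseteq> S)"

text \<open>
  For a finite nonempty graph the maximum ranges over a finite nonempty set, as \<open>{}\<close> is convex.
\<close>

definition convexity_number :: "('a, 'b) pre_digraph \<Rightarrow> nat" where
  "convexity_number G = Max (card ` {S. geodesically_convex G S \<and> S \<noteq> verts G})"

definition max_degree_on :: "('a, 'b) pre_digraph \<Rightarrow> 'a set \<Rightarrow> nat" where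
  "max_degree_on G A = Max (out_degree G ` A)"

abbreviation max_degree :: "('a, 'b) pre_digraph \<Rightarrow> nat" where
  "max_degree G \<equiv> max_degree_on G (verts G)"

definition num_pendant_nbrs :: "('a, 'b) pre_digraph \<Rightarrow> 'a \<Rightarrow> nat" where
  "num_pendant_nbrs G x = card {y \<in> verts G. x \<rightarrow>\<^bsub>G\<^esub> y \<and> out_degree G y = 1}"

definition complement_graph :: "'a pair_pre_digraph \<Rightarrow> 'a pair_pre_digraph" where
  "complement_graph G =
     \<lparr> pverts = pverts G,
       parcs = {(u, v). u \<in> pverts G \<and> v \<in> pverts G \<and> u \<noteq> v \<and> (u, v) \<notin> parcs G} \<rparr>"

text \<open>\<open>Inl v\<close> is the vertex \<open>v\<close> of \<open>G\<close>, and \<open>Inr v\<close> is its copy in the complement.\<close>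

definition complementary_prism :: "'a pair_pre_digraph \<Rightarrow> ('a + 'a) pair_pre_digraph" where
  "complementary_prism G =
     \<lparr> pverts = pverts G <+> pverts G,
       parcs = {(Inl u, Inl v) | u v. (u, v) \<in> parcs G}
             \<union> {(Inr u, Inr v) | u v. (u, v) \<in> parcs (complement_graph G)}
             \<union> {(Inl v, Inr v) | v. v \<in> pverts G}
             \<union> {(Inr v, Inl v) | v. v \<in> pverts G} \<rparr>"

lemma pair_graph_complementary_prism:
  assumes "pair_graph G"
  shows "pair_graph (complementary_prism G)"
proof -
  interpret pair_graph G by (rule assms)
  let ?P = "complementary_prism G"
  have sub: "parcs ?P \<subseteq> pverts ?P \<times> pverts ?P"
    using wellformed' by (auto simp: complementary_prism_def complement_graph_def)
  have fin: "finite (pverts ?P)"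
    by (simp add: complementary_prism_def)
  have "sym (parcs G)"
    using pair_sym_arcs by (simp add: symmetric_def)
  then have sym: "sym (parcs ?P)"
    unfolding sym_def by (auto simp: complementary_prism_def complement_graph_def)
  have irr: "fst e \<noteq> snd e" if "e \<in> parcs ?P" for e
    using that pair_no_loops
    by (fastforce simp: complementary_prism_def complement_graph_def)
  show ?thesis
    using sub fin sym irr finite_subset[OF sub]
    by unfold_locales (auto simp: symmetric_def)
qed

end

theory Submission
  imports Defs
begin

text \<open>
  Write a vertex set of the prism as a pair \<open>(A, B)\<close>: the part in \<open>T\<close> and the part in the complement.
  The prism has diameter at most 3, so convexity of \<open>(A, B)\<close> becomes a finite list of closure
  conditions in terms of adjacency in \<open>T\<close>. A tree of diameter 4 consists of the centre \<open>c\<close>, its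
  neighbours \<open>N\<close> and the leaves \<open>L\<close> below them. For a proper convex pair either some \<open>u \<in> A\<close>
  lies outside \<open>B\<close>, which forces \<open>B\<close> into the neighbourhood of \<open>u\<close> and \<open>A\<close> into a star, or
  \<open>A \<subseteq> B\<close> and \<open>A\<close> is a union of components of the subgraph induced by \<open>B\<close>. In the latter case
  \<open>A\<close> is contained in one branch at \<open>c\<close>, or consists of leaves whose parents are missing
  from \<open>B\<close>, or consists of \<open>c\<close> and some of its neighbours. Counting gives the three bounds,
  and each is attained.
\<close>

section \<open>Shortest paths and convexity criteria\<close>

context wf_digraph
begin

lemma hop_dist_le_iff:
  "hop_dist G u v \<le> ereal (real n) \<longleftrightarrow> (\<exists>p. awalk u p v \<and> length p \<le> n)"
proof
  assume "hop_dist G u v \<le> ereal (real n)"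
  \<comment> \<open>A strict bound is what produces an actual walk from the infimum;
    \<open>Suc n\<close> loses nothing because lengths are integers.\<close>
  also have "\<dots> < ereal (real (Suc n))" by simp
  finally obtain p where "awalk u p v" "ereal (awalk_cost (\<lambda>_. 1) p) < ereal (real (Suc n))"
    unfolding hop_dist_def \<mu>_def Inf_less_iff by auto
  then show "\<exists>p. awalk u p v \<and> length p \<le> n" by (auto simp: awalk_cost_def sum_list_triv)
next
  assume "\<exists>p. awalk u p v \<and> length p \<le> n"
  then obtain p where p: "awalk u p v" "length p \<le> n" by blast
  have "hop_dist G u v \<le> ereal (awalk_cost (\<lambda>_. 1) p)"
    unfolding hop_dist_def using p(1) by (rule min_cost_le_walk_cost)
  with p(2) show "hop_dist G u v \<le> ereal (real n)"
    by (simp add: awalk_cost_def sum_list_triv order_trans)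
qed

text \<open>Trades the extended-real distance for a comparison of walk lengths, so that convexity
  can be argued with natural numbers.\<close>

lemma shortest_path_iff:
  "shortest_path G u p v \<longleftrightarrow> apath u p v \<and> (\<forall>q. awalk u q v \<longrightarrow> length p \<le> length q)"
proof -
  have "ereal (real (length p)) = hop_dist G u v \<longleftrightarrow> (\<forall>q. awalk u q v \<longrightarrow> length p \<le> length q)"
    if "awalk u p v"
  proof
    assume *: "ereal (real (length p)) = hop_dist G u v"
    show "\<forall>q. awalk u q v \<longrightarrow> length p \<le> length q"
    proof (intro allI impI)
      fix q assume "awalk u q v"
      then have "hop_dist G u v \<le> ereal (real (length q))" unfolding hop_dist_le_iff by blast
      with * show "length p \<le> length q" by (metis ereal_less_eq(3) of_nat_le_iff)
    qed
  next
    assume "\<forall>q. awalk u q v \<longrightarrow> length p \<le> length q"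
    then have "ereal (real (length p)) \<le> hop_dist G u v"
      unfolding hop_dist_def \<mu>_def by (intro INF_greatest) (auto simp: awalk_cost_def sum_list_triv)
    moreover have "hop_dist G u v \<le> ereal (real (length p))"
      unfolding hop_dist_le_iff using that by blast
    ultimately show "ereal (real (length p)) = hop_dist G u v" by order
  qed
  then show ?thesis unfolding shortest_path_def by (auto simp: apath_def)
qed

lemma awalk_imp_relpow: "awalk u p v \<Longrightarrow> (u, v) \<in> arcs_ends G ^^ length p"
proof (induction p arbitrary: u)
  case (Cons e p)
  then have "(u, head G e) \<in> arcs_ends G" "(head G e, v) \<in> arcs_ends G ^^ length p"
    by (auto simp: awalk_Cons_iff intro: in_arcs_imp_in_arcs_ends)
  then show ?case by (auto intro: relpow_Suc_I2 simp del: relpow.simps)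
qed (simp add: awalk_Nil_iff)

lemma relpow_imp_awalk:
  "u \<in> verts G \<Longrightarrow> (u, v) \<in> arcs_ends G ^^ n \<Longrightarrow> \<exists>p. awalk u p v \<and> length p = n"
proof (induction n arbitrary: u)
  case (Suc n)
  from relpow_Suc_D2[OF Suc.prems(2)] obtain w
    where w: "(u, w) \<in> arcs_ends G" "(w, v) \<in> arcs_ends G ^^ n" by blast
  from w(1) obtain e where e: "e \<in> arcs G" "tail G e = u" "head G e = w" by (rule reachableE)
  from Suc.IH[OF _ w(2)] e obtain p where "awalk w p v" "length p = n" by auto
  with e have "awalk u (e # p) v" "length (e # p) = Suc n" by (auto simp: awalk_Cons_iff)
  then show ?case by blast
qed (auto simp: awalk_Nil_iff)

end

section \<open>Convexity tested on pairs at distance 2 and 3\<close>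

context pair_wf_digraph
begin

text \<open>Distinct non-adjacent ends exclude walks of length 0 and 1, so the two arcs through
  \<open>w\<close> form a shortest path.\<close>

lemma geodesically_convexD2:
  assumes S: "geodesically_convex (with_proj G) S" "u \<in> S" "v \<in> S"
    and uv: "u \<noteq> v" "(u, v) \<notin> parcs G"
    and w: "(u, w) \<in> parcs G" "(w, v) \<in> parcs G"
  shows "w \<in> S"
proof -
  have "apath u [(u, w), (w, v)] v"
    using assms by (auto simp: apath_Cons_iff apath_Nil_iff dest: in_arcsD1 in_arcsD2)
  moreover have "2 \<le> length q" if "awalk u q v" for q
    using that uv by (cases q; cases "tl q") (auto simp: awalk_Cons_iff awalk_Nil_iff)
  ultimately have "shortest_path (with_proj G) u [(u, w), (w, v)] v"
    unfolding shortest_path_iff by force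
  with S have "set (awalk_verts u [(u, w), (w, v)]) \<subseteq> S"
    unfolding geodesically_convex_def awalk_verts_with_proj_eq by blast
  then show ?thesis by simp
qed

lemma geodesically_convexD3:
  assumes S: "geodesically_convex (with_proj G) S" "u \<in> S" "v \<in> S"
    and uv: "u \<noteq> v" "(u, v) \<notin> parcs G" "\<And>z. (u, z) \<in> parcs G \<Longrightarrow> (z, v) \<notin> parcs G"
    and w: "(u, w) \<in> parcs G" "(w, x) \<in> parcs G" "(x, v) \<in> parcs G"
  shows "w \<in> S \<and> x \<in> S"
\<comment> \<open>Loops are not excluded here, but \<open>w = x\<close> would give a walk of length
  2 from \<open>u\<close> to \<open>v\<close>, against \<open>uv\<close>.\<close>
proof (cases "w = x")
  case True
  with assms show ?thesis by blast
next
  case False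
  have "apath u [(u, w), (w, x), (x, v)] v"
    using assms False by (auto simp: apath_Cons_iff apath_Nil_iff dest: in_arcsD1 in_arcsD2)
  moreover have "3 \<le> length q" if "awalk u q v" for q
    using that uv
    by (cases q; cases "tl q"; cases "tl (tl q)") (auto simp: awalk_Cons_iff awalk_Nil_iff)
  ultimately have "shortest_path (with_proj G) u [(u, w), (w, x), (x, v)] v"
    unfolding shortest_path_iff by force
  with S have "set (awalk_verts u [(u, w), (w, x), (x, v)]) \<subseteq> S"
    unfolding geodesically_convex_def awalk_verts_with_proj_eq by blast
  then show ?thesis by simp
qed

text \<open>If walks of length at most 3 join the points of \<open>S\<close>, shortest paths between
  them have at most two inner vertices, so lengths 2 and 3 are the only ones to test.\<close>

lemma geodesically_convexI_diam3:
  assumes sub: "S \<subseteq> pverts G"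
    and diam: "\<And>u v. u \<in> S \<Longrightarrow> v \<in> S \<Longrightarrow> \<exists>p. awalk u p v \<and> length p \<le> 3"
    and c2: "\<And>u v w. u \<in> S \<Longrightarrow> v \<in> S \<Longrightarrow> u \<noteq> v \<Longrightarrow> (u, v) \<notin> parcs G \<Longrightarrow>
      (u, w) \<in> parcs G \<Longrightarrow> (w, v) \<in> parcs G \<Longrightarrow> w \<in> S"
    and c3: "\<And>u v w x. u \<in> S \<Longrightarrow> v \<in> S \<Longrightarrow> u \<noteq> v \<Longrightarrow> (u, v) \<notin> parcs G \<Longrightarrow>
      (\<And>z. (u, z) \<in> parcs G \<Longrightarrow> (z, v) \<notin> parcs G) \<Longrightarrow>
      (u, w) \<in> parcs G \<Longrightarrow> (w, x) \<in> parcs G \<Longrightarrow> (x, v) \<in> parcs G \<Longrightarrow> w \<in> S \<and> x \<in> S"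
  shows "geodesically_convex (with_proj G) S"
  unfolding geodesically_convex_def
proof (intro conjI ballI allI impI)
  show "S \<subseteq> verts (with_proj G)" using sub by simp
next
  fix u v p
  assume uv: "u \<in> S" "v \<in> S" and "shortest_path (with_proj G) u p v"
  then have p: "awalk u p v" "distinct (awalk_verts u p)"
    and short: "\<And>q. awalk u q v \<Longrightarrow> length p \<le> length q"
    unfolding shortest_path_iff by (auto simp: apath_def)
  from diam[OF uv] short have len: "length p \<le> 3" by force
  have no1: "(u, v) \<notin> parcs G" if "length p > 1"
    using short[of "[(u, v)]"] that
    by (auto simp: awalk_Cons_iff awalk_Nil_iff dest: in_arcsD1 in_arcsD2)
  have no2: "(z, v) \<notin> parcs G" if "length p > 2" "(u, z) \<in> parcs G" for z
    using short[of "[(u, z), (z, v)]"] that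
    by (auto simp: awalk_Cons_iff awalk_Nil_iff dest: in_arcsD1 in_arcsD2)
  consider "p = []" | e where "p = [e]" | e f where "p = [e, f]" | e f g where "p = [e, f, g]"
    using len by (cases p; cases "tl p"; cases "tl (tl p)") auto
  then have "set (awalk_verts u p) \<subseteq> S"
  proof cases
    case 1 with uv show ?thesis by simp
  next
    case 2 with uv p show ?thesis by (auto simp: awalk_Cons_iff awalk_Nil_iff)
  next
    case (3 e f)
    with p have ef: "e = (u, snd e)" "f = (snd e, v)" "e \<in> parcs G" "f \<in> parcs G" "u \<noteq> v"
      by (auto simp: awalk_Cons_iff awalk_Nil_iff prod_eq_iff)
    then have "snd e \<in> S" using c2[OF uv, of "snd e"] no1 3 by simp
    with 3 ef uv show ?thesis by (auto simp: prod_eq_iff)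
  next
    case (4 e f g)
    with p have ef: "e = (u, snd e)" "f = (snd e, snd f)" "g = (snd f, v)"
      "e \<in> parcs G" "f \<in> parcs G" "g \<in> parcs G" "u \<noteq> v"
      by (auto simp: awalk_Cons_iff awalk_Nil_iff prod_eq_iff)
    then have "snd e \<in> S \<and> snd f \<in> S"
      using c3[OF uv, of "snd e" "snd f"] no1 no2 4 by auto
    with 4 ef uv show ?thesis by (auto simp: prod_eq_iff)
  qed
  then show "set (pre_digraph.awalk_verts (with_proj G) u p) \<subseteq> S" by simp
qed

end

section \<open>Distances in trees\<close>

text \<open>Acyclicity is encoded as every edge being a bridge, over a plain symmetric relation.
  Contradictions then come from distance levels: it is enough to link the ends of a deleted edge
  through some root.\<close>

locale bridge_tree =
  fixes V :: "'a set" and A :: "('a \<times> 'a) set"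
  assumes arcs_sub: "A \<subseteq> V \<times> V"
    and arcs_sym: "(u, v) \<in> A \<Longrightarrow> (v, u) \<in> A"
    and linked: "u \<in> V \<Longrightarrow> v \<in> V \<Longrightarrow> (u, v) \<in> A\<^sup>*"
    and bridge: "(u, v) \<in> A \<Longrightarrow> (u, v) \<notin> (A - {(u, v), (v, u)})\<^sup>*"
begin

definition hops :: "'a \<Rightarrow> 'a \<Rightarrow> nat" where
  "hops u v = (LEAST n. (u, v) \<in> A ^^ n)"

lemma arc_in: "(u, v) \<in> A \<Longrightarrow> u \<in> V" "(u, v) \<in> A \<Longrightarrow> v \<in> V"
  using arcs_sub by auto

lemma hops_le: "(u, v) \<in> A ^^ n \<Longrightarrow> hops u v \<le> n"
  unfolding hops_def by (rule Least_le)

lemma hops_relpow: "u \<in> V \<Longrightarrow> v \<in> V \<Longrightarrow> (u, v) \<in> A ^^ hops u v"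
  unfolding hops_def using linked[THEN rtrancl_imp_relpow] by (rule LeastI_ex)

lemma relpow_sym: "(u, v) \<in> A ^^ n \<Longrightarrow> (v, u) \<in> A ^^ n"
proof (induction n arbitrary: v)
  case (Suc n)
  then obtain w where "(u, w) \<in> A ^^ n" "(w, v) \<in> A" by auto
  with Suc.IH arcs_sym show ?case by (meson relpow_Suc_I2)
qed simp

lemma hops_sym: "hops u v = hops v u"
  unfolding hops_def by (rule arg_cong[where f = Least]) (auto intro: relpow_sym)

lemma hops_triangle:
  assumes "u \<in> V" "v \<in> V" "w \<in> V"
  shows "hops u w \<le> hops u v + hops v w"
proof (rule hops_le)
  show "(u, w) \<in> A ^^ (hops u v + hops v w)"
    unfolding relpow_add using hops_relpow[OF assms(1,2)] hops_relpow[OF assms(2,3)] by (rule relcompI)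
qed

lemma hops_arc: "u \<in> V \<Longrightarrow> (v, w) \<in> A \<Longrightarrow> hops u w \<le> Suc (hops u v)"
  by (rule hops_le, rule relpow_Suc_I, rule hops_relpow[OF _ arc_in(1)])

lemma hops_0: "u \<in> V \<Longrightarrow> v \<in> V \<Longrightarrow> hops u v = 0 \<longleftrightarrow> u = v"
  using hops_relpow[of u v] hops_le[of u v 0] by (cases "hops u v") auto

lemma hops_SucE:
  assumes "u \<in> V" "w \<in> V" "hops u w = Suc k"
  obtains v where "(v, w) \<in> A" "hops u v = k"
proof -
  from hops_relpow[OF assms(1,2)] assms(3) obtain v where v: "(u, v) \<in> A ^^ k" "(v, w) \<in> A" by auto
  from hops_le[OF v(1)] hops_arc[OF assms(1) v(2)] assms(3) have "hops u v = k" by simp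
  with v(2) that show ?thesis by blast
qed

text \<open>A geodesic from \<open>r\<close> climbs one level per arc, so \<open>R\<close> only has
  to contain the climbing arcs up to level \<open>k\<close>. With \<open>R\<close> the tree minus an
  edge, this tells which vertices stay reachable.\<close>

lemma hops_reach:
  assumes "r \<in> V" "w \<in> V" "hops r w \<le> k"
    and "\<And>a b. (a, b) \<in> A \<Longrightarrow> hops r b = Suc (hops r a) \<Longrightarrow> hops r b \<le> k \<Longrightarrow> (a, b) \<in> R"
  shows "(r, w) \<in> R\<^sup>*"
  using assms(2,3)
proof (induction "hops r w" arbitrary: w)
  case 0
  with assms(1) hops_0 show ?case by simp
next
  case (Suc n)
  obtain v where v: "(v, w) \<in> A" "hops r v = n"
    using hops_SucE[OF assms(1) Suc.prems(1) Suc.hyps(2)[symmetric]] .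
  have "(r, v) \<in> R\<^sup>*" using Suc.hyps v Suc.prems arc_in by (intro Suc.hyps(1)) auto
  moreover have "(v, w) \<in> R" using v Suc by (intro assms(4)) auto
  ultimately show ?case by (rule rtrancl_into_rtrancl)
qed

lemma del_edge_sym:
  assumes "(x, y) \<in> (A - {(u, v), (v, u)})\<^sup>*"
  shows "(y, x) \<in> (A - {(u, v), (v, u)})\<^sup>*"
proof -
  have "sym (A - {(u, v), (v, u)})" by (auto simp: sym_def intro: arcs_sym)
  with assms show ?thesis by (meson sym_rtrancl symD)
qed

text \<open>An edge inside one level of \<open>r\<close> lies on no geodesic from \<open>r\<close>;
  after its deletion both ends would still be linked through \<open>r\<close>, so it would not be a
  bridge.\<close>

lemma hops_arc_neq:
  assumes "r \<in> V" "(u, v) \<in> A"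
  shows "hops r u \<noteq> hops r v"
proof
  let ?R = "A - {(u, v), (v, u)}"
  assume eq: "hops r u = hops r v"
  have "(r, w) \<in> ?R\<^sup>*" if "w \<in> {u, v}" for w
    using assms that arc_in eq by (intro hops_reach[where k = "hops r u"]) auto
  then have "(u, v) \<in> ?R\<^sup>*" using del_edge_sym by (meson insertCI rtrancl_trans)
  with bridge assms show False by blast
qed

text \<open>Geodesics to \<open>u\<close> and \<open>v\<close> stay below the level of
  \<open>w\<close>. With two lower neighbours, \<open>w\<close> would remain linked to
  \<open>u\<close> through \<open>v\<close> after the edge between \<open>u\<close> and
  \<open>w\<close> is deleted.\<close>

lemma hops_parent_unique:
  assumes "r \<in> V" "(u, w) \<in> A" "(v, w) \<in> A" "hops r u < hops r w" "hops r v < hops r w"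
  shows "u = v"
proof (rule ccontr)
  assume "u \<noteq> v"
  let ?R = "A - {(u, w), (w, u)}"
  have "(r, x) \<in> ?R\<^sup>*" if "x \<in> {u, v}" for x
    using assms that arc_in by (intro hops_reach[where k = "hops r w - 1"]) auto
  then have "(u, v) \<in> ?R\<^sup>*" using del_edge_sym by (meson insertCI rtrancl_trans)
  moreover have "(v, w) \<in> ?R" using assms \<open>u \<noteq> v\<close> by auto
  ultimately have "(u, w) \<in> ?R\<^sup>*" by (rule rtrancl_into_rtrancl)
  with bridge assms show False by blast
qed

text \<open>A path moving away from the root cannot turn back: \<open>u\<close> is the only
  neighbour of \<open>w\<close> nearer to \<open>r\<close>, and no neighbour of \<open>w\<close>
  shares its level.\<close>

lemma hops_increase:
  assumes "r \<in> V" "(u, w) \<in> A" "(w, v) \<in> A" "u \<noteq> v" "hops r u < hops r w"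
  shows "hops r v = Suc (hops r w)"
proof -
  have "\<not> hops r v < hops r w"
    using hops_parent_unique[OF assms(1,2) arcs_sym[OF assms(3)] assms(5)] assms(4) by blast
  then show ?thesis using hops_arc_neq[OF assms(1,3)] hops_arc[OF assms(1,3)] by simp
qed

text \<open>The middle \<open>m\<close> of a diametral path works. From a vertex \<open>w\<close> at
  distance 3 or more from \<open>m\<close>, at least one half of the path leads away, and its end
  would be at distance 5 or more.\<close>

lemma center_exists:
  assumes "a \<in> V" "b \<in> V" "hops a b = 4" and diam: "\<And>u v. u \<in> V \<Longrightarrow> v \<in> V \<Longrightarrow> hops u v \<le> 4"
  shows "\<exists>m \<in> V. \<forall>w \<in> V. hops m w \<le> 2"
proof -
  have "hops a b = Suc 3" using assms(3) by simp
  then obtain v3 where v3: "(v3, b) \<in> A" "hops a v3 = 3"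
    by (rule hops_SucE[OF assms(1,2)])
  then have "v3 \<in> V" "hops a v3 = Suc 2" using arc_in by auto
  then obtain m where m: "(m, v3) \<in> A" "hops a m = 2"
    by (rule hops_SucE[OF assms(1)])
  then have "m \<in> V" "hops a m = Suc 1" using arc_in by auto
  then obtain v1 where v1: "(v1, m) \<in> A" "hops a v1 = 1"
    by (rule hops_SucE[OF assms(1)])
  then have "v1 \<in> V" "hops a v1 = Suc 0" using arc_in by auto
  then obtain v0 where v0: "(v0, v1) \<in> A" "hops a v0 = 0"
    by (rule hops_SucE[OF assms(1)])
  have "b \<noteq> m" "v0 \<noteq> m" "v1 \<noteq> v3" using assms v3 m v1 v0 by auto
  have "hops m w \<le> 2" if w: "w \<in> V" for w
  proof (rule ccontr)
    assume "\<not> hops m w \<le> 2"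
    then have far: "hops w m \<ge> 3" by (simp add: hops_sym)
    have turn: False if "(m, x) \<in> A" "(x, y) \<in> A" "y \<noteq> m" "hops w x > hops w m" for x y
    proof -
      have "hops w y = Suc (hops w x)"
        using that w by (intro hops_increase[of w m x y]) auto
      with far that(4) diam[OF w, of y] arc_in(2)[OF that(2)] show False by simp
    qed
    show False
    proof (cases "hops w v1 > hops w m")
      case True
      with turn[of v1 v0] v1 v0 \<open>v0 \<noteq> m\<close> arcs_sym show False by blast
    next
      case False
      \<comment> \<open>Seen from \<open>w\<close>, the lower neighbour of \<open>m\<close> is now
        \<open>v1\<close>, so the other half through \<open>v3\<close> leads away.\<close>
      then have "hops w v1 < hops w m" using hops_arc_neq[OF w v1(1)] by simp
      then have "hops w v3 = Suc (hops w m)"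
        using w v1 m \<open>v1 \<noteq> v3\<close> by (intro hops_increase[of w v1 m v3]) auto
      with turn[of v3 b] m v3 \<open>b \<noteq> m\<close> show False by simp
    qed
  qed
  with \<open>m \<in> V\<close> show ?thesis by blast
qed

end

lemma (in pair_graph) bridge_tree_if_undirected_tree:
  assumes "undirected_tree G"
  shows "bridge_tree (pverts G) (parcs G)"
proof
  show "parcs G \<subseteq> pverts G \<times> pverts G" using wellformed' by auto
  show "(v, u) \<in> parcs G" if "(u, v) \<in> parcs G" for u v
    using that arcs_symmetric by blast
  show "(u, v) \<in> (parcs G)\<^sup>*" if "u \<in> pverts G" "v \<in> pverts G" for u v
  proof -
    have "connected (with_proj G)" using assms by (simp add: undirected_tree_def)
    then have "u \<rightarrow>\<^sup>*\<^bsub>mk_symmetric (with_proj G)\<^esub> v"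
      using that unfolding connected_def strongly_connected_def by simp
    then have "u \<rightarrow>\<^sup>*\<^bsub>with_proj G\<^esub> v" using reachable_mk_symmetric_eq[OF sym_arcs] by simp
    then show ?thesis unfolding reachable_def with_proj_simps by (rule rtrancl_on_rtranclI)
  qed
  show "(u, v) \<notin> (parcs G - {(u, v), (v, u)})\<^sup>*" if uv: "(u, v) \<in> parcs G" for u v
  proof
    \<comment> \<open>The path is built in the graph without the edge, so shortening a walk to a
      path cannot bring the edge back.\<close>
    let ?H = "\<lparr>pverts = pverts G, parcs = parcs G - {(u, v), (v, u)}\<rparr>"
    interpret H: pair_wf_digraph ?H by unfold_locales (auto dest: wellformed')
    assume "(u, v) \<in> (parcs G - {(u, v), (v, u)})\<^sup>*"
    then obtain n where "(u, v) \<in> (parcs G - {(u, v), (v, u)}) ^^ n"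
      by (blast dest: rtrancl_imp_relpow)
    then obtain p0 where "H.awalk u p0 v"
      using H.relpow_imp_awalk[of u v n] wellformed'(1)[OF uv] by auto
    then have p: "H.apath u (H.awalk_to_apath p0) v" by (rule H.apath_awalk_to_apath)
    define p where "p = H.awalk_to_apath p0"
    have walk: "awalk u p v" and dist: "distinct (pawalk_verts u p)" and notin: "(u, v) \<notin> set p"
      using p by (auto simp: p_def H.apath_def H.awalk_def awalk_def)
    have "u \<noteq> v" using uv no_loops' by blast
    \<comment> \<open>The path has distinct ends and avoids the edge, hence has at least two arcs;
      the closing arc raises this to the length 3 in \<open>undirected_tree\<close>.\<close>
    then have len: "2 \<le> length p" using walk notin
      by (cases p; cases "tl p") (auto simp: awalk_Cons_iff awalk_Nil_iff)
    have "(v, u) \<in> parcs G" using uv arcs_symmetric by blast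
    then have "awalk v [(v, u)] u" by (auto simp: awalk_Cons_iff awalk_Nil_iff dest: wellformed')
    with walk have closed: "awalk u (p @ [(v, u)]) u" by (rule awalk_appendI)
    moreover have "distinct (tl (awalk_verts u (p @ [(v, u)])))"
    proof -
      obtain q where q: "pawalk_verts u p = u # q"
        using walk by (cases p) (auto simp: awalk_Cons_iff)
      have "awalk_verts u (p @ [(v, u)]) = u # q @ [u]"
        using awalk_verts_append[OF closed] q by simp
      with dist q show ?thesis by simp
    qed
    ultimately have "cycle (p @ [(v, u)])" "length (p @ [(v, u)]) \<ge> 3"
      using len by (auto simp: cycle_def)
    with assms show False unfolding undirected_tree_def by blast
  qed
qed

section \<open>Convex sets of complementary prisms\<close>

text \<open>Convexity in the prism of the set with part \<open>A\<close> in the graph and part \<open>B\<close> in the complement. The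
  closure conditions come from pairs in \<open>A\<close> at distance 2, pairs in \<open>A\<close> at distance 3, pairs in \<open>B\<close>
  at distance 2, and mixed pairs.\<close>

definition prism_convex :: "'a set \<Rightarrow> ('a \<times> 'a) set \<Rightarrow> 'a set \<Rightarrow> 'a set \<Rightarrow> bool" where
  "prism_convex V E A B \<longleftrightarrow> A \<subseteq> V \<and> B \<subseteq> V \<and>
    (\<forall>u \<in> A. \<forall>v \<in> A. \<forall>w. u \<noteq> v \<longrightarrow> (u, v) \<notin> E \<longrightarrow> (u, w) \<in> E \<longrightarrow> (w, v) \<in> E \<longrightarrow> w \<in> A) \<and>
    (\<forall>u \<in> A. \<forall>v \<in> A. u \<noteq> v \<longrightarrow> (u, v) \<notin> E \<longrightarrow> (\<forall>z. (u, z) \<in> E \<longrightarrow> (z, v) \<notin> E) \<longrightarrow>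
      u \<in> B \<and> v \<in> B \<and>
      (\<forall>w x. (u, w) \<in> E \<longrightarrow> (w, x) \<in> E \<longrightarrow> (x, v) \<in> E \<longrightarrow> w \<in> A \<and> x \<in> A)) \<and>
    (\<forall>u \<in> B. \<forall>v \<in> B. \<forall>w \<in> V. (u, v) \<in> E \<longrightarrow> w \<noteq> u \<longrightarrow> w \<noteq> v \<longrightarrow>
      (u, w) \<notin> E \<longrightarrow> (w, v) \<notin> E \<longrightarrow> w \<in> B) \<and>
    (\<forall>u \<in> A. \<forall>v \<in> B. u \<noteq> v \<longrightarrow> (u, v) \<notin> E \<longrightarrow> u \<in> B) \<and>
    (\<forall>u \<in> A. \<forall>v \<in> B. (u, v) \<in> E \<longrightarrow> v \<in> A)"

lemmas prism_convexD = prism_convex_def[THEN iffD1]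

lemma prism_convex_sub: "prism_convex V E A B \<Longrightarrow> A \<subseteq> V \<and> B \<subseteq> V"
  unfolding prism_convex_def by (elim conjE) (rule conjI)

lemmas prism_convex_between = prism_convexD[THEN conjunct2, THEN conjunct2, THEN conjunct1, rule_format]

lemmas prism_convex_far_all =
  prism_convexD[THEN conjunct2, THEN conjunct2, THEN conjunct2, THEN conjunct1, rule_format]

lemmas prism_convex_far =
  prism_convex_far_all[THEN conjunct1]
  prism_convex_far_all[THEN conjunct2, THEN conjunct1]
  prism_convex_far_all[THEN conjunct2, THEN conjunct2, rule_format]

lemmas prism_convex_edge =
  prism_convexD[THEN conjunct2, THEN conjunct2, THEN conjunct2, THEN conjunct2, THEN conjunct1, rule_format]

lemmas prism_convex_cross =
  prism_convexD[THEN conjunct2, THEN conjunct2, THEN conjunct2, THEN conjunct2, THEN conjunct2,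
    THEN conjunct1, rule_format]
  prism_convexD[THEN conjunct2, THEN conjunct2, THEN conjunct2, THEN conjunct2, THEN conjunct2,
    THEN conjunct2, rule_format]

lemma in_Plus_iff: "Inl x \<in> A <+> B \<longleftrightarrow> x \<in> A" "Inr y \<in> A <+> B \<longleftrightarrow> y \<in> B"
  by auto

lemma parcs_complementary_prism:
  "(Inl u, Inl v) \<in> parcs (complementary_prism G) \<longleftrightarrow> (u, v) \<in> parcs G"
  "(Inr u, Inr v) \<in> parcs (complementary_prism G) \<longleftrightarrow>
     u \<in> pverts G \<and> v \<in> pverts G \<and> u \<noteq> v \<and> (u, v) \<notin> parcs G"
  "(Inl u, Inr v) \<in> parcs (complementary_prism G) \<longleftrightarrow> u = v \<and> u \<in> pverts G"
  "(Inr u, Inl v) \<in> parcs (complementary_prism G) \<longleftrightarrow> u = v \<and> u \<in> pverts G"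
  by (auto simp: complementary_prism_def complement_graph_def)

lemma pverts_complementary_prism: "pverts (complementary_prism G) = pverts G <+> pverts G"
  by (simp add: complementary_prism_def)

section \<open>From convex sets of the prism to convex pairs and back\<close>

context pair_graph
begin

lemma prism_convexI:
  assumes "geodesically_convex (with_proj (complementary_prism G)) S"
  shows "prism_convex (pverts G) (parcs G) {a. Inl a \<in> S} {b. Inr b \<in> S}"
proof -
  let ?P = "complementary_prism G"
  interpret P: pair_graph ?P by (rule pair_graph_complementary_prism) unfold_locales
  note D2 = P.geodesically_convexD2[OF assms] and D3 = P.geodesically_convexD3[OF assms]
  note arcs = parcs_complementary_prism
  have "S \<subseteq> pverts G <+> pverts G"
    using assms unfolding geodesically_convex_def by (simp add: pverts_complementary_prism)
  then have sub: "Inl u \<in> S \<Longrightarrow> u \<in> pverts G" "Inr u \<in> S \<Longrightarrow> u \<in> pverts G" for u by auto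
  \<comment> \<open>A copy cannot be the midpoint of two vertices of \<open>G\<close>, as it has
    only its original as a neighbour there.\<close>
  have nocommon: "(Inl u, z) \<in> parcs ?P \<Longrightarrow> (z, Inl v) \<notin> parcs ?P"
    if "\<And>z. (u, z) \<in> parcs G \<Longrightarrow> (z, v) \<notin> parcs G" "u \<noteq> v" for u v z
    using that by (cases z) (auto simp: arcs)
  \<comment> \<open>Vertices at distance 3 or more in \<open>G\<close> are at distance 3 in the
    prism through their copies, which are therefore forced even when the distance in
    \<open>G\<close> is larger.\<close>
  have far: "Inr u \<in> S \<and> Inr v \<in> S"
    if "Inl u \<in> S" "Inl v \<in> S" "u \<noteq> v" "(u, v) \<notin> parcs G"
      "\<And>z. (u, z) \<in> parcs G \<Longrightarrow> (z, v) \<notin> parcs G" for u v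
  proof (rule D3[OF that(1,2)])
    show "(z, Inl v) \<notin> parcs ?P" if "(Inl u, z) \<in> parcs ?P" for z
      using nocommon[OF \<open>\<And>z. (u, z) \<in> parcs G \<Longrightarrow> (z, v) \<notin> parcs G\<close> \<open>u \<noteq> v\<close> that] .
  qed (use that sub in \<open>simp_all add: arcs\<close>)
  have far': "Inl w \<in> S \<and> Inl x \<in> S"
    if "Inl u \<in> S" "Inl v \<in> S" "u \<noteq> v" "(u, v) \<notin> parcs G"
      "\<And>z. (u, z) \<in> parcs G \<Longrightarrow> (z, v) \<notin> parcs G"
      "(u, w) \<in> parcs G" "(w, x) \<in> parcs G" "(x, v) \<in> parcs G" for u v w x
  proof (rule D3[OF that(1,2)])
    show "(z, Inl v) \<notin> parcs ?P" if "(Inl u, z) \<in> parcs ?P" for z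
      using nocommon[OF \<open>\<And>z. (u, z) \<in> parcs G \<Longrightarrow> (z, v) \<notin> parcs G\<close> \<open>u \<noteq> v\<close> that] .
  qed (use that sub in \<open>simp_all add: arcs\<close>)
  have between: "Inl w \<in> S"
    if "Inl u \<in> S" "Inl v \<in> S" "u \<noteq> v" "(u, v) \<notin> parcs G" "(u, w) \<in> parcs G" "(w, v) \<in> parcs G"
    for u v w using that by (intro D2[of "Inl u" "Inl v" "Inl w"]) (simp_all add: arcs)
  \<comment> \<open>Adjacent vertices have non-adjacent copies, and the common non-neighbours supply
    the midpoints.\<close>
  have edge: "Inr w \<in> S"
    if "Inr u \<in> S" "Inr v \<in> S" "w \<in> pverts G" "(u, v) \<in> parcs G" "w \<noteq> u" "w \<noteq> v"
      "(u, w) \<notin> parcs G" "(w, v) \<notin> parcs G" for u v w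
  proof -
    have "u \<noteq> v" using that(4) no_loops' by blast
    with that show ?thesis by (intro D2[of "Inr u" "Inr v" "Inr w"]) (simp_all add: arcs sub)
  qed
  \<comment> \<open>A vertex \<open>u\<close> and the copy of another vertex \<open>v\<close> have a
    single midpoint: the copy of \<open>u\<close> if \<open>u\<close> and \<open>v\<close> are
    non-adjacent, and \<open>v\<close> itself otherwise.\<close>
  have cross: "Inr u \<in> S" if "Inl u \<in> S" "Inr v \<in> S" "u \<noteq> v" "(u, v) \<notin> parcs G" for u v
    using that by (intro D2[of "Inl u" "Inr v" "Inr u"]) (simp_all add: arcs sub)
  have cross': "Inl v \<in> S" if "Inl u \<in> S" "Inr v \<in> S" "(u, v) \<in> parcs G" for u v
  proof -
    have "u \<noteq> v" using that(3) no_loops' by blast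
    with that show ?thesis by (intro D2[of "Inl u" "Inr v" "Inl v"]) (simp_all add: arcs sub)
  qed
  show ?thesis
    unfolding prism_convex_def
  proof (intro conjI ballI allI impI, goal_cases)
    case 1 then show ?case using sub by blast
  next
    case 2 then show ?case using sub by blast
  next
    case (3 u v w) then show ?case using between[of u v w] by simp
  next
    case (4 u v) then show ?case using far[of u v] by simp
  next
    case (5 u v) then show ?case using far[of u v] by simp
  next
    case (6 u v w x) then show ?case using far'[of u v w x] by simp
  next
    case (7 u v w x) then show ?case using far'[of u v w x] by simp
  next
    case (8 u v w) then show ?case using edge[of u v w] by simp
  next
    case (9 u v) then show ?case using cross[of u v] by simp
  next
    case (10 u v) then show ?case using cross'[of u v] by simp
  qed
qed

text \<open>Copies of adjacent vertices without a common non-neighbour would be at distance 3, joined by a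
  shortest path through \<open>G\<close> itself.\<close>

lemma geodesically_convex_PlusI:
  assumes conv: "prism_convex (pverts G) (parcs G) A B"
    and nonnbr: "\<And>u v. (u, v) \<in> parcs G \<Longrightarrow>
      \<exists>w \<in> pverts G. w \<noteq> u \<and> w \<noteq> v \<and> (u, w) \<notin> parcs G \<and> (w, v) \<notin> parcs G"
  shows "geodesically_convex (with_proj (complementary_prism G)) (A <+> B)"
proof -
  let ?P = "complementary_prism G"
  interpret P: pair_graph ?P by (rule pair_graph_complementary_prism) unfold_locales
  note arcs = parcs_complementary_prism
  note AB = prism_convex_sub[OF conv]
  have sym: "(u, v) \<in> parcs G \<longleftrightarrow> (v, u) \<in> parcs G" for u v using arcs_symmetric by blast
  show ?thesis
  proof (rule P.geodesically_convexI_diam3)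
    show "A <+> B \<subseteq> pverts ?P" using AB by (auto simp: pverts_complementary_prism)
  next
    fix s t assume "s \<in> A <+> B" "t \<in> A <+> B"
    then have st: "s \<in> pverts ?P" "t \<in> pverts ?P" using AB by (auto simp: pverts_complementary_prism)
    \<comment> \<open>Non-adjacent vertices of \<open>G\<close> are joined through their copies,
      non-adjacent copies through their originals, and a mixed pair needs at most one vertex in
      between.\<close>
    have "s = t \<or> (s, t) \<in> parcs ?P \<or> (\<exists>z. (s, z) \<in> parcs ?P \<and> (z, t) \<in> parcs ?P) \<or>
      (\<exists>w x. (s, w) \<in> parcs ?P \<and> (w, x) \<in> parcs ?P \<and> (x, t) \<in> parcs ?P)"
    proof -
      consider (ll) u v where "s = Inl u" "t = Inl v" | (lr) u v where "s = Inl u" "t = Inr v"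
        | (rl) u v where "s = Inr u" "t = Inl v" | (rr) u v where "s = Inr u" "t = Inr v"
        by (cases s; cases t)
      then show ?thesis
      proof cases
        case ll
        then have "s = t \<or> (s, t) \<in> parcs ?P \<or>
            (s, Inr u) \<in> parcs ?P \<and> (Inr u, Inr v) \<in> parcs ?P \<and> (Inr v, t) \<in> parcs ?P"
          using st by (auto simp: arcs pverts_complementary_prism)
        then show ?thesis by blast
      next
        case lr
        then have "(s, t) \<in> parcs ?P \<or> (s, Inr u) \<in> parcs ?P \<and> (Inr u, t) \<in> parcs ?P \<or>
            (s, Inl v) \<in> parcs ?P \<and> (Inl v, t) \<in> parcs ?P"
          using st by (auto simp: arcs pverts_complementary_prism)
        then show ?thesis by blast
      next
        case rl
        then have "(s, t) \<in> parcs ?P \<or> (s, Inr v) \<in> parcs ?P \<and> (Inr v, t) \<in> parcs ?P \<or>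
            (s, Inl u) \<in> parcs ?P \<and> (Inl u, t) \<in> parcs ?P"
          using st by (auto simp: arcs pverts_complementary_prism)
        then show ?thesis by blast
      next
        case rr
        then have "s = t \<or> (s, t) \<in> parcs ?P \<or>
            (s, Inl u) \<in> parcs ?P \<and> (Inl u, Inl v) \<in> parcs ?P \<and> (Inl v, t) \<in> parcs ?P"
          using st by (auto simp: arcs pverts_complementary_prism)
        then show ?thesis by blast
      qed
    qed
    then have "\<exists>n \<le> 3. (s, t) \<in> parcs ?P ^^ n"
    proof (elim disjE exE conjE)
      fix w x assume "(s, w) \<in> parcs ?P" "(w, x) \<in> parcs ?P" "(x, t) \<in> parcs ?P"
      then have "(s, t) \<in> parcs ?P ^^ 3" by (auto simp: numeral_3_eq_3)
      then show ?thesis by blast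
    next
      fix z assume "(s, z) \<in> parcs ?P" "(z, t) \<in> parcs ?P"
      then have "(s, t) \<in> parcs ?P ^^ 2" by (auto simp: numeral_2_eq_2)
      then show ?thesis by (intro exI[of _ 2]) simp
    next
      assume "(s, t) \<in> parcs ?P"
      then show ?thesis by (intro exI[of _ 1]) simp
    next
      assume "s = t"
      then show ?thesis by (intro exI[of _ 0]) simp
    qed
    then obtain n where n: "n \<le> 3" "(s, t) \<in> parcs ?P ^^ n" by blast
    obtain p where "P.awalk s p t" "length p = n"
      using P.relpow_imp_awalk[of s t n] st n by auto
    with n show "\<exists>p. P.awalk s p t \<and> length p \<le> 3" by blast
  next
    fix s t r
    assume st: "s \<in> A <+> B" "t \<in> A <+> B" "s \<noteq> t" "(s, t) \<notin> parcs ?P"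
      and r: "(s, r) \<in> parcs ?P" "(r, t) \<in> parcs ?P"
    consider (ll) u v where "s = Inl u" "t = Inl v" | (lr) u v where "s = Inl u" "t = Inr v"
      | (rl) u v where "s = Inr u" "t = Inl v" | (rr) u v where "s = Inr u" "t = Inr v"
      by (cases s; cases t)
    then show "r \<in> A <+> B"
    proof cases
      case ll
      then show ?thesis
        using prism_convex_between[OF conv, of u v] st r by (cases r) (auto simp: arcs)
    next
      case lr
      then show ?thesis
        using prism_convex_cross[OF conv, of u v] st r by (cases r) (auto simp: arcs)
    next
      case rl
      then show ?thesis
        using prism_convex_cross[OF conv, of v u] sym[of u v] st r by (cases r) (auto simp: arcs)
    next
      case rr
      then show ?thesis
        using prism_convex_edge[OF conv, of u v] st r by (cases r) (auto simp: arcs)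
    qed
  next
    fix s t w x
    assume st: "s \<in> A <+> B" "t \<in> A <+> B" "s \<noteq> t" "(s, t) \<notin> parcs ?P"
      and no: "\<And>z. (s, z) \<in> parcs ?P \<Longrightarrow> (z, t) \<notin> parcs ?P"
      and wx: "(s, w) \<in> parcs ?P" "(w, x) \<in> parcs ?P" "(x, t) \<in> parcs ?P"
    have V: "s \<in> pverts ?P" "t \<in> pverts ?P" using st AB by (auto simp: pverts_complementary_prism)
    consider (ll) u v where "s = Inl u" "t = Inl v" | (lr) u v where "s = Inl u" "t = Inr v"
      | (rl) u v where "s = Inr u" "t = Inl v" | (rr) u v where "s = Inr u" "t = Inr v"
      by (cases s; cases t)
    \<comment> \<open>Only two vertices of \<open>G\<close> can be at distance 3: a mixed pair is
      adjacent or has a midpoint, and non-adjacent copies have one by \<open>nonnbr\<close>.\<close>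
    then show "w \<in> A <+> B \<and> x \<in> A <+> B"
    proof cases
      case ll
      have noc: "(z, v) \<notin> parcs G" if "(u, z) \<in> parcs G" for z
        using no[of "Inl z"] that ll by (simp add: arcs)
      have uv: "u \<in> A" "v \<in> A" "u \<noteq> v" "(u, v) \<notin> parcs G" using st ll by (auto simp: arcs)
      note far = prism_convex_far[OF conv uv noc]
      show ?thesis
        using far(1,2) far(3)[of "projl w" "projl x"] uv wx ll
        by (cases w; cases x) (auto simp: arcs)
    next
      case lr
      with no[of "Inr u"] no[of "Inl v"] V st(4) have False
        by (auto simp: arcs pverts_complementary_prism)
      then show ?thesis ..
    next
      case rl
      with no[of "Inr v"] no[of "Inl u"] V st(4) have False
        by (auto simp: arcs pverts_complementary_prism)
      then show ?thesis ..
    next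
      case rr
      with V st have uv: "(u, v) \<in> parcs G" "u \<in> pverts G" "v \<in> pverts G"
        by (auto simp: arcs pverts_complementary_prism)
      from nonnbr[OF uv(1)] obtain z where "z \<in> pverts G" "z \<noteq> u" "z \<noteq> v"
        "(u, z) \<notin> parcs G" "(z, v) \<notin> parcs G" by blast
      with no[of "Inr z"] rr uv have False by (simp add: arcs)
      then show ?thesis ..
    qed
  qed
qed

section \<open>The convexity number as a maximum over convex pairs\<close>

lemma finite_proper_prism_convex:
  "finite {S. geodesically_convex (with_proj (complementary_prism G)) S \<and>
    S \<noteq> verts (with_proj (complementary_prism G))}"
proof (rule finite_subset)
  show "{S. geodesically_convex (with_proj (complementary_prism G)) S \<and>
      S \<noteq> verts (with_proj (complementary_prism G))} \<subseteq> Pow (pverts G <+> pverts G)"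
    unfolding geodesically_convex_def with_proj_simps pverts_complementary_prism by blast
qed simp

lemma convexity_number_prism_le:
  assumes "pverts G \<noteq> {}"
    and "\<And>A B. prism_convex (pverts G) (parcs G) A B \<Longrightarrow> A \<noteq> pverts G \<or> B \<noteq> pverts G \<Longrightarrow>
      card A + card B \<le> k"
  shows "convexity_number (with_proj (complementary_prism G)) \<le> k"
proof -
  let ?P = "complementary_prism G"
  let ?C = "{S. geodesically_convex (with_proj ?P) S \<and> S \<noteq> verts (with_proj ?P)}"
  have "finite ?C" by (rule finite_proper_prism_convex)
  then have "finite (card ` ?C)" by (rule finite_imageI)
  \<comment> \<open>This keeps the set under \<open>Max\<close> nonempty.\<close>
  moreover have "{} \<in> ?C"
  proof -
    have "verts (with_proj ?P) \<noteq> {}"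
      using assms(1) by (simp add: pverts_complementary_prism)
    then show ?thesis unfolding geodesically_convex_def by blast
  qed
  moreover have "card S \<le> k" if "S \<in> ?C" for S
  proof -
    let ?A = "{a. Inl a \<in> S}" and ?B = "{b. Inr b \<in> S}"
    have S: "S = ?A <+> ?B"
    proof (rule set_eqI)
      show "x \<in> S \<longleftrightarrow> x \<in> ?A <+> ?B" for x by (cases x) (simp_all add: in_Plus_iff)
    qed
    have conv: "prism_convex (pverts G) (parcs G) ?A ?B" using that prism_convexI by blast
    have "finite ?A" "finite ?B"
      using prism_convex_sub[OF conv] finite_subset[OF _ finite_verts] by simp_all
    then have "card S = card ?A + card ?B" by (subst S) (simp add: card_Plus)
    also have "\<dots> \<le> k"
    proof (rule assms(2)[OF conv])
      have "S \<noteq> pverts G <+> pverts G" using that by (simp add: pverts_complementary_prism)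
      then show "?A \<noteq> pverts G \<or> ?B \<noteq> pverts G" using S by metis
    qed
    finally show ?thesis .
  qed
  ultimately show ?thesis unfolding convexity_number_def by (subst Max_le_iff) blast+
qed

lemma convexity_number_prism_ge:
  assumes "prism_convex (pverts G) (parcs G) A B" "A \<noteq> pverts G \<or> B \<noteq> pverts G"
    and "\<And>u v. (u, v) \<in> parcs G \<Longrightarrow>
      \<exists>w \<in> pverts G. w \<noteq> u \<and> w \<noteq> v \<and> (u, w) \<notin> parcs G \<and> (w, v) \<notin> parcs G"
  shows "card A + card B \<le> convexity_number (with_proj (complementary_prism G))"
proof -
  let ?P = "complementary_prism G"
  let ?C = "{S. geodesically_convex (with_proj ?P) S \<and> S \<noteq> verts (with_proj ?P)}"
  have "finite ?C" by (rule finite_proper_prism_convex)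
  moreover have "A <+> B \<in> ?C"
  proof -
    have "A <+> B \<noteq> pverts G <+> pverts G"
    proof
      assume eq: "A <+> B = pverts G <+> pverts G"
      have "x \<in> A \<longleftrightarrow> x \<in> pverts G" "x \<in> B \<longleftrightarrow> x \<in> pverts G" for x
        using arg_cong[OF eq, of "\<lambda>S. Inl x \<in> S"] arg_cong[OF eq, of "\<lambda>S. Inr x \<in> S"]
        unfolding in_Plus_iff by simp_all
      with assms(2) show False by blast
    qed
    with geodesically_convex_PlusI[OF assms(1,3)] show ?thesis
      by (simp add: pverts_complementary_prism)
  qed
  moreover have "card (A <+> B) = card A + card B"
    using prism_convex_sub[OF assms(1)] finite_subset[OF _ finite_verts] by (simp add: card_Plus)
  ultimately have "card A + card B \<in> card ` ?C" by (metis (no_types, lifting) imageI)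
  then show ?thesis unfolding convexity_number_def
    by (rule Max_ge[OF finite_imageI[OF \<open>finite ?C\<close>]])
qed

end

section \<open>Trees of depth two\<close>

text \<open>\<open>c\<close> is the root, \<open>N\<close> its children, \<open>L\<close> the leaves
  below them and \<open>p\<close> the parent map on \<open>L\<close>. Leaves with different parents
  are at distance 4, so \<open>two_branches\<close> fixes the diameter. The children outside the
  image of \<open>L\<close> under \<open>p\<close> are the pendant neighbours of
  \<open>c\<close>.\<close>

locale depth2_tree =
  fixes c :: 'a and N L :: "'a set" and p :: "'a \<Rightarrow> 'a"
  assumes fin: "finite N" "finite L"
    and disj: "c \<notin> N" "c \<notin> L" "N \<inter> L = {}"
    and p_in: "l \<in> L \<Longrightarrow> p l \<in> N"
    and two_branches: "\<exists>l \<in> L. \<exists>l' \<in> L. p l \<noteq> p l'"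
begin

definition V :: "'a set" where "V = insert c (N \<union> L)"

definition E :: "('a \<times> 'a) set" where
  "E = {(u, v). u = c \<and> v \<in> N \<or> v = c \<and> u \<in> N \<or> v \<in> L \<and> u = p v \<or> u \<in> L \<and> v = p u}"

definition lf :: "'a \<Rightarrow> 'a set" where "lf y = {l \<in> L. p l = y}"

lemma E_iff: "(u, v) \<in> E \<longleftrightarrow> u = c \<and> v \<in> N \<or> v = c \<and> u \<in> N \<or> v \<in> L \<and> u = p v \<or> u \<in> L \<and> v = p u"
  by (simp add: E_def)

lemma lf_sub: "lf y \<subseteq> L" by (auto simp: lf_def)

lemma fin_lf [simp]: "finite (lf y)" using lf_sub fin(2) by (rule finite_subset)

lemma fin_V [simp]: "finite V" using fin by (simp add: V_def)

lemma card_V: "card V = 1 + card N + card L"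
  using fin disj by (simp add: V_def card_Un_disjoint)

lemma other_branch:
  obtains l where "l \<in> L" "p l \<noteq> y"
  using two_branches by metis

lemma neqs: "n \<in> N \<Longrightarrow> n \<noteq> c" "l \<in> L \<Longrightarrow> l \<noteq> c" "l \<in> L \<Longrightarrow> n \<in> N \<Longrightarrow> l \<noteq> n"
  "l \<in> L \<Longrightarrow> p l \<noteq> c" "l \<in> L \<Longrightarrow> l' \<in> L \<Longrightarrow> p l \<noteq> l'" "l \<in> L \<Longrightarrow> l \<notin> N" "n \<in> N \<Longrightarrow> n \<notin> L"
  "l \<in> L \<Longrightarrow> p l \<notin> L"
  using disj p_in by blast+

lemmas kind_simps = neqs neqs(1-5)[symmetric] p_in disj(1,2)

lemma E_sym: "(u, v) \<in> E \<longleftrightarrow> (v, u) \<in> E"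
  by (auto simp: E_iff)

lemma nbrs_center: "{v. (c, v) \<in> E} = N"
  by (auto simp: E_iff kind_simps)

lemma nbrs_child: "y \<in> N \<Longrightarrow> {v. (y, v) \<in> E} = insert c (lf y)"
  by (auto simp: E_iff lf_def kind_simps)

lemma nbrs_leaf: "l \<in> L \<Longrightarrow> {v. (l, v) \<in> E} = {p l}"
  by (auto simp: E_iff kind_simps)

lemma c_notin_lf: "c \<notin> lf y"
  by (simp add: lf_def kind_simps)

text \<open>Every edge belongs to the branch of one child of \<open>c\<close>, and a leaf of another
  branch is adjacent to neither end. Hence copies are never at distance 3.\<close>

lemma common_nonneighbour:
  assumes "(u, v) \<in> E"
  shows "\<exists>w \<in> V. w \<noteq> u \<and> w \<noteq> v \<and> (u, w) \<notin> E \<and> (w, v) \<notin> E"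
proof -
  have *: "\<exists>w \<in> V. w \<noteq> u \<and> w \<noteq> v \<and> (u, w) \<notin> E \<and> (w, v) \<notin> E"
    if uv: "u = c \<and> v \<in> N \<or> v \<in> L \<and> u = p v" for u v
  proof -
    obtain l where "l \<in> L" "p l \<noteq> (if u = c then v else u)" using other_branch .
    with uv have "l \<in> V \<and> l \<noteq> u \<and> l \<noteq> v \<and> (u, l) \<notin> E \<and> (l, v) \<notin> E"
      by (auto simp: E_iff V_def kind_simps split: if_splits)
    then show ?thesis by blast
  qed
  from assms consider "u = c \<and> v \<in> N \<or> v \<in> L \<and> u = p v" | "v = c \<and> u \<in> N \<or> u \<in> L \<and> v = p u"
    unfolding E_iff by blast
  then show ?thesis
  proof cases
    case 1 then show ?thesis by (rule *)
  next
    case 2 from *[OF this] show ?thesis using E_sym by blast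
  qed
qed

section \<open>Upper bounds for convex pairs\<close>

context
  fixes A B assumes conv: "prism_convex V E A B"
begin

lemma AB_sub: "A \<subseteq> V" "B \<subseteq> V"
  using prism_convex_sub[OF conv] by auto

lemma fin_AB: "finite A" "finite B"
  using AB_sub by (auto intro: finite_subset)

text \<open>With every copy in \<open>B\<close>, the mixed pairs make \<open>A\<close> closed under
  adjacency, and the tree is connected. So a proper pair with nonempty \<open>A\<close> misses a
  copy.\<close>

lemma full_if_complement_full:
  assumes "B = V" "A \<noteq> {}"
  shows "A = V"
proof -
  have step: "v \<in> A" if "u \<in> A" "(u, v) \<in> E" "v \<in> V" for u v
    using prism_convex_cross(2)[OF conv, of u v] that assms by blast
  from assms(2) AB_sub obtain a where a: "a \<in> A" "a \<in> V" by blast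
  have up: "c \<in> A" if "n \<in> N" "n \<in> A" for n using step[of n c] that by (simp add: E_iff V_def)
  have up': "p l \<in> A" if "l \<in> L" "l \<in> A" for l using step[of l "p l"] that p_in by (simp add: E_iff V_def)
  have "c \<in> A" using a up up' p_in unfolding V_def by blast
  then have N: "n \<in> A" if "n \<in> N" for n using step[of c n] that by (simp add: E_iff V_def)
  then have "l \<in> A" if "l \<in> L" for l using step[of "p l" l] that p_in by (simp add: E_iff V_def)
  with N \<open>c \<in> A\<close> AB_sub show ?thesis by (auto simp: V_def)
qed

text \<open>The geodesic of the tree would pass through \<open>c\<close>. Two leaves of different
  branches escape this: at distance 4 in the tree, their only shortest path in the prism runs
  through their copies.\<close>

lemma same_branch_if_avoiding_center:
  assumes "c \<notin> A" "a \<in> A" "a' \<in> A"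
  shows "a \<in> N \<Longrightarrow> a' \<in> N \<Longrightarrow> a = a'" "a \<in> N \<Longrightarrow> a' \<in> L \<Longrightarrow> p a' = a"
proof -
  assume "a \<in> N" "a' \<in> N"
  with prism_convex_between[OF conv assms(2,3), of c] assms(1) show "a = a'"
    by (auto simp: E_iff kind_simps)
next
  assume a: "a \<in> N" "a' \<in> L"
  show "p a' = a"
  proof (rule ccontr)
    assume ne: "p a' \<noteq> a"
    have "c \<in> A \<and> p a' \<in> A"
    proof (rule prism_convex_far(3)[OF conv assms(2,3)])
      show "(a, z) \<in> E \<Longrightarrow> (z, a') \<notin> E" for z
        using a ne p_in by (auto simp: E_iff kind_simps)
    qed (use a ne p_in in \<open>auto simp: E_iff kind_simps\<close>)
    with assms(1) show False by simp
  qed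
qed

text \<open>Each leaf in \<open>A\<close> is traded for its parent; the parents are distinct and
  missing from \<open>B\<close>, so everything is counted inside \<open>V\<close>.\<close>

lemma scattered_card_le:
  assumes "A \<subseteq> L" and parents: "\<And>l. l \<in> A \<Longrightarrow> p l \<notin> B" "inj_on p A"
  shows "card A + card B \<le> card V"
proof -
  have "card A + card B = card (p ` A) + card B" using parents(2) by (simp add: card_image)
  also have "\<dots> = card (p ` A \<union> B)"
    using parents(1) fin_AB by (intro card_Un_disjoint[symmetric]) auto
  also have "\<dots> \<le> card V"
    using AB_sub assms(1) by (intro card_mono fin_V) (auto simp: V_def kind_simps)
  finally show ?thesis .
qed

text \<open>Either \<open>A\<close> lies in one branch, which has at most \<open>D\<close> vertices
  while \<open>B\<close> misses one, or \<open>A\<close> consists of leaves and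
  \<open>scattered_card_le\<close> applies.\<close>

lemma card_le_avoiding_center:
  assumes "c \<notin> A" "A \<noteq> {}" "A \<subseteq> B" and D: "\<And>y. y \<in> N \<Longrightarrow> 1 + card (lf y) \<le> D"
    and B: "B \<noteq> V"
  shows "card A + card B \<le> card V + D - 1"
proof -
  have cB: "card B < card V" using B AB_sub by (intro psubset_card_mono) auto
  have branch: ?thesis if "y \<in> N" "A \<subseteq> insert y (lf y)" for y
  proof -
    have "card A \<le> card (insert y (lf y))" using that by (intro card_mono) auto
    also have "\<dots> \<le> D" using D[OF that(1)] card_insert_le_m1 by (simp add: card_insert_if)
    finally show ?thesis using cB by simp
  qed
  show ?thesis
  proof (cases "\<exists>y \<in> N. A \<subseteq> insert y (lf y)")
    case True with branch show ?thesis by blast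
  next
    case False
    have AL: "A \<subseteq> L"
    proof
      fix a assume a: "a \<in> A"
      show "a \<in> L"
      proof (rule ccontr)
        assume "a \<notin> L"
        with a assms(1) AB_sub have "a \<in> N" by (auto simp: V_def)
        moreover from this have "A \<subseteq> insert a (lf a)"
          using same_branch_if_avoiding_center[OF assms(1) a] AB_sub assms(1) by (auto simp: V_def lf_def)
        ultimately show False using False by blast
      qed
    qed
    \<comment> \<open>A parent in \<open>B\<close> would enter \<open>A\<close> as the midpoint of a
      mixed pair, but \<open>A\<close> contains only leaves.\<close>
    have parent: "p l \<notin> B" if "l \<in> A" for l
    proof
      assume "p l \<in> B"
      have l: "l \<in> L" using AL that by blast
      then have "p l \<in> A" using \<open>p l \<in> B\<close> by (intro prism_convex_cross(2)[OF conv that]) (auto simp: E_iff)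
      with AL l show False by (auto simp: kind_simps)
    qed
    \<comment> \<open>Two leaves with a common parent would put it, as their midpoint, into
      \<open>A\<close> and so into \<open>B\<close>.\<close>
    moreover have "inj_on p A"
    proof (rule inj_onI, rule ccontr)
      fix l l' assume l: "l \<in> A" "l' \<in> A" "p l = p l'" "l \<noteq> l'"
      moreover have "l \<in> L" "l' \<in> L" using l AL by auto
      ultimately have "p l \<in> A"
        by (intro prism_convex_between[OF conv l(1,2)]) (auto simp: E_iff kind_simps)
      with parent[OF l(1)] assms(3) show False by blast
    qed
    ultimately have "card A + card B \<le> card V" using AL by (intro scattered_card_le) auto
    moreover have "D \<ge> 1" using D two_branches p_in by fastforce
    ultimately show ?thesis by simp
  qed
qed

text \<open>An edge inside \<open>B\<close> pulls in all vertices adjacent to neither end. A leaf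
  edge yields all children and all leaves of other branches; \<open>c\<close> is adjacent to every
  child and has to be assumed.\<close>

lemma center_leaf_edge_full:
  assumes "l \<in> L" "l \<in> B" "p l \<in> B" "c \<in> B"
  shows "B = V"
proof -
  note edge = prism_convex_edge[OF conv]
  have spread: "n \<in> N \<Longrightarrow> n \<in> B" "l' \<in> L \<Longrightarrow> p l' \<noteq> p l \<Longrightarrow> l' \<in> B"
    if "l \<in> L" "l \<in> B" "p l \<in> B" for l l' n
  proof -
    show "n \<in> B" if "n \<in> N"
    proof (cases "n = p l")
      case False
      then show ?thesis using that \<open>l \<in> L\<close> p_in
        by (intro edge[of "p l" l n]) (use \<open>l \<in> B\<close> \<open>p l \<in> B\<close> in \<open>auto simp: E_iff V_def kind_simps\<close>)
    qed (use \<open>p l \<in> B\<close> in simp)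
    show "l' \<in> B" if "l' \<in> L" "p l' \<noteq> p l"
      using that \<open>l \<in> L\<close> p_in
      by (intro edge[of "p l" l l']) (use \<open>l \<in> B\<close> \<open>p l \<in> B\<close> in \<open>auto simp: E_iff V_def kind_simps\<close>)
  qed
  \<comment> \<open>A leaf edge of a second branch brings in the remaining leaves of the
    first.\<close>
  obtain l' where l': "l' \<in> L" "p l' \<noteq> p l" using other_branch .
  have "l' \<in> B" "p l' \<in> B" using spread[OF assms(1-3)] l' p_in by auto
  then have "l'' \<in> B" if "l'' \<in> L" for l''
    using spread(2)[OF assms(1-3)] spread(2)[of l' l''] l' that by metis
  with spread(1)[OF assms(1-3)] assms(4) AB_sub show ?thesis by (auto simp: V_def)
qed

text \<open>As \<open>B\<close> is not full, it contains no leaf edge, and so \<open>A\<close>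
  contains no leaf. If a parent of a leaf is in \<open>B\<close>, then \<open>A\<close> has at most
  two elements; otherwise only pendant children are left beside \<open>c\<close> and, in
  \<open>B\<close>, the leaves.\<close>

lemma card_le_with_center:
  assumes "c \<in> A" "A \<subseteq> B" and D: "\<And>y. y \<in> N \<Longrightarrow> 1 + card (lf y) \<le> D"
    and B: "B \<noteq> V"
  shows "card A + card B \<le> card V + D - 1 \<or> card A + card B \<le> 2 + 2 * card (N - p ` L) + card L"
proof -
  have c: "c \<in> B" using assms by blast
  have no_edge: "l \<notin> B" if "l \<in> L" "p l \<in> B" for l
    using center_leaf_edge_full that c B by blast
  have A_L: "l \<notin> A" if "l \<in> L" for l
  proof
    assume l: "l \<in> A"
    then have "p l \<in> A"
      using assms(1) that p_in by (intro prism_convex_between[OF conv assms(1) l]) (auto simp: E_iff kind_simps)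
    with no_edge[OF that] l assms(2) show False by blast
  qed
  have spread: "l \<in> B" if "y \<in> N" "y \<in> B" "l \<in> L" "p l \<noteq> y" for y l
    using that c by (intro prism_convex_edge[OF conv c that(2)]) (auto simp: E_iff V_def kind_simps)
  show ?thesis
  proof (cases "\<exists>l \<in> L. p l \<in> B")
    case True
    then obtain l where l: "l \<in> L" "p l \<in> B" by blast
    \<comment> \<open>The edge from \<open>c\<close> to a second child in \<open>B\<close> would
      pull \<open>l\<close> into \<open>B\<close>, against \<open>no_edge\<close>.\<close>
    have "y = p l" if "y \<in> N" "y \<in> B" for y
      using spread[OF that l(1)] no_edge[OF l] by blast
    then have "A \<subseteq> {c, p l}" using A_L AB_sub assms(2) unfolding V_def by blast
    then have "card A \<le> card {c, p l}" by (intro card_mono) auto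
    also have "\<dots> \<le> 2" by (simp add: card_insert_if)
    also have "2 \<le> 1 + card (lf (p l))"
    proof -
      have "lf (p l) \<noteq> {}" using l by (auto simp: lf_def)
      then show ?thesis by (simp add: Suc_le_eq card_gt_0_iff)
    qed
    also have "\<dots> \<le> D" using D l p_in by blast
    finally have "card A \<le> D" .
    moreover have "card B < card V" using B AB_sub by (intro psubset_card_mono) auto
    ultimately have "card A + card B \<le> card V + D - 1" by simp
    then show ?thesis ..
  next
    case False
    let ?P = "N - p ` L"
    have "A \<subseteq> insert c ?P" "B \<subseteq> insert c (?P \<union> L)"
      using False A_L AB_sub assms(2) by (auto simp: V_def)
    then have "card A \<le> card (insert c ?P)" "card B \<le> card (insert c (?P \<union> L))"
      using fin by (auto intro: card_mono)
    moreover have "card (insert c ?P) = 1 + card ?P" using fin disj by simp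
    moreover have "card (insert c (?P \<union> L)) = 1 + card ?P + card L"
      using fin disj by (subst card_insert_disjoint) (auto intro!: card_Un_disjoint)
    ultimately show ?thesis by simp
  qed
qed

text \<open>If \<open>u\<close> is in \<open>A\<close> but not in \<open>B\<close>, the mixed pairs
  make every element of \<open>B\<close> a neighbour of \<open>u\<close>. Two elements of
  \<open>A\<close> at distance 3 or more would both lie in \<open>B\<close>, hence share the
  neighbour \<open>u\<close>. So \<open>B\<close> fits into a neighbourhood and \<open>A\<close>
  into a closed one.\<close>

lemma card_le_not_subset:
  assumes "\<not> A \<subseteq> B" and D: "\<And>y. y \<in> N \<Longrightarrow> 1 + card (lf y) \<le> D" and N: "card N \<le> D"
  shows "card A + card B \<le> 2 * D + 1"
proof -
  have star: "card {v. (u, v) \<in> E} \<le> D \<and> finite {v. (u, v) \<in> E}" if "u \<in> V" for u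
  proof -
    from that consider "u = c" | "u \<in> N" | "u \<in> L" by (auto simp: V_def)
    then show ?thesis
    proof cases
      case 1
      with N fin nbrs_center show ?thesis by simp
    next
      case 2
      with D[OF 2] nbrs_child[OF 2] show ?thesis by (simp add: card_insert_if)
    next
      case 3
      with D[OF p_in[OF 3]] nbrs_leaf[OF 3] show ?thesis by simp
    qed
  qed
  from assms(1) obtain u where u: "u \<in> A" "u \<notin> B" by blast
  have "(u, v) \<in> E" if "v \<in> B" for v using prism_convex_cross(1)[OF conv u(1) that] u that by blast
  then have Bu: "B \<subseteq> {v. (u, v) \<in> E}" by blast
  with star[of u] u AB_sub have cB: "card B \<le> D" by (meson card_mono in_mono order_trans)
  have near: "x = y \<or> (x, y) \<in> E \<or> (\<exists>z. (x, z) \<in> E \<and> (z, y) \<in> E)" if "x \<in> A" "y \<in> A" for x y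
  proof (rule ccontr)
    assume *: "\<not> ?thesis"
    with prism_convex_far[OF conv that] have "x \<in> B" "y \<in> B" by blast+
    with Bu E_sym * show False by blast
  qed
  \<comment> \<open>All distances in \<open>A\<close> are at most 2: a leaf in \<open>A\<close>
    gathers the rest around its parent, and without leaves \<open>A\<close> surrounds
    \<open>c\<close>.\<close>
  have "\<exists>v \<in> V. A \<subseteq> insert v {w. (v, w) \<in> E}"
  proof (cases "\<exists>l \<in> L. l \<in> A")
    case True
    then obtain l where l: "l \<in> L" "l \<in> A" by blast
    have "x = p l \<or> (p l, x) \<in> E" if "x \<in> A" for x
      using near[OF l(2) that] l p_in by (auto simp: E_iff kind_simps)
    moreover have "p l \<in> V" using l p_in by (auto simp: V_def)
    ultimately show ?thesis by blast
  next
    case False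
    then have "A \<subseteq> insert c {w. (c, w) \<in> E}" using AB_sub by (auto simp: V_def E_iff)
    then show ?thesis by (auto simp: V_def)
  qed
  then obtain v where v: "v \<in> V" "A \<subseteq> insert v {w. (v, w) \<in> E}" by blast
  have "card A \<le> card (insert v {w. (v, w) \<in> E})" using v star by (intro card_mono) auto
  also have "\<dots> \<le> D + 1" using star[OF v(1)] by (simp add: card_insert_if)
  finally show ?thesis using cB by simp
qed

end

text \<open>\<open>D'\<close> bounds the degrees of the children and \<open>D\<close> all degrees.
  The third bound is \<open>n + 2e - card N + 1\<close>, with \<open>n\<close> vertices and
  \<open>e\<close> pendant neighbours of \<open>c\<close>, rewritten by \<open>card_V\<close>
  without subtraction.\<close>

lemma prism_convex_card_le:
  assumes conv: "prism_convex V E A B" and proper: "A \<noteq> V \<or> B \<noteq> V"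
    and D': "\<And>y. y \<in> N \<Longrightarrow> 1 + card (lf y) \<le> D'" and D: "D' \<le> D" "card N \<le> D"
  shows "card A + card B \<le> card V + D' - 1 \<or> card A + card B \<le> 2 * D + 1 \<or>
    card A + card B \<le> 2 + 2 * card (N - p ` L) + card L"
proof -
  have "D' \<ge> 1" using D' two_branches p_in by fastforce
  consider "A = {}" | "\<not> A \<subseteq> B" | "A \<noteq> {}" "A \<subseteq> B" "c \<notin> A" | "A \<subseteq> B" "c \<in> A" by blast
  then show ?thesis
  proof cases
    case 1
    have "card B \<le> card V" using prism_convex_sub[OF conv] by (intro card_mono) auto
    with 1 \<open>D' \<ge> 1\<close> have "card A + card B \<le> card V + D' - 1" by simp
    then show ?thesis ..
  next
    case 2
    have "card A + card B \<le> 2 * D + 1"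
    proof (rule card_le_not_subset[OF conv 2 _ D(2)])
      show "1 + card (lf y) \<le> D" if "y \<in> N" for y using D'[OF that] D by simp
    qed
    then show ?thesis by simp
  next
    case 3
    with full_if_complement_full[OF conv] proper have "B \<noteq> V" by blast
    with card_le_avoiding_center[OF conv 3(3,1,2) D'] show ?thesis by blast
  next
    case 4
    with full_if_complement_full[OF conv] proper have "B \<noteq> V" by blast
    with card_le_with_center[OF conv 4(2,1) D'] show ?thesis by blast
  qed
qed

section \<open>Convex pairs attaining the bounds\<close>

lemma prism_convex_branch:
  assumes y: "y \<in> N"
  shows "prism_convex V E (insert y (lf y)) (V - {c})"
  unfolding prism_convex_def
proof (intro conjI ballI allI impI, goal_cases)
  case 1 from y show ?case by (auto simp: V_def lf_def)
next
  case 2 show ?case by blast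
next
  case (3 u v w)
  then have "u \<in> lf y" "(u, w) \<in> E" by (auto simp: lf_def E_iff)
  with y show ?case by (auto simp: lf_def E_iff kind_simps)
next
  case (4 u v) with y show ?case by (auto simp: lf_def V_def kind_simps)
next
  case (5 u v) with y show ?case by (auto simp: lf_def V_def kind_simps)
next
  case (6 u v w x)
  then have "u \<in> lf y" "v \<in> lf y" by (auto simp: lf_def E_iff)
  with 6(5) have False by (auto simp: lf_def E_iff)
  then show ?case ..
next
  case (7 u v w x)
  then have "u \<in> lf y" "v \<in> lf y" by (auto simp: lf_def E_iff)
  with 7(5) have False by (auto simp: lf_def E_iff)
  then show ?case ..
next
  case (8 u v w)
  \<comment> \<open>Every edge has an end in \<open>N\<close>, which is adjacent to
    \<open>c\<close>; so no edge inside \<open>B\<close> ever demands the missing copy of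
    \<open>c\<close>.\<close>
  then have "u \<in> N \<or> v \<in> N" by (auto simp: E_iff p_in)
  with 8(7,8) have "w \<noteq> c" by (auto simp: E_iff)
  with 8(3) show ?case by blast
next
  case (9 u v) with y show ?case by (auto simp: V_def lf_def kind_simps)
next
  case (10 u v)
  show ?case
  proof (cases "u = y")
    case True
    with 10(2,3) nbrs_child[OF y] show ?thesis by blast
  next
    case False
    with 10(1) have "u \<in> L" "p u = y" by (simp_all add: lf_def)
    with 10(3) nbrs_leaf[of u] show ?thesis by blast
  qed
qed

text \<open>\<open>N\<close> is independent, so no edge inside \<open>B\<close> demands a further
  copy, and the children have the common neighbour \<open>c\<close>. The pair has
  \<open>2 * card N + 1\<close> elements.\<close>

lemma prism_convex_center_star: "prism_convex V E (insert c N) N"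
  unfolding prism_convex_def
proof (intro conjI ballI allI impI, goal_cases)
  case 1 show ?case by (auto simp: V_def)
next
  case 2 show ?case by (auto simp: V_def)
next
  case (3 u v w)
  then have "u \<in> N" "v \<in> N" by (auto simp: E_iff)
  with 3(3,5,6) show ?case by (auto simp: E_iff kind_simps)
next
  case (4 u v) then show ?case by (auto simp: E_iff)
next
  case (5 u v) then show ?case by (auto simp: E_iff)
next
  case (6 u v w x)
  then have "u \<in> N" "v \<in> N" by (auto simp: E_iff)
  with 6(5) have False by (auto simp: E_iff)
  then show ?case ..
next
  case (7 u v w x)
  then have "u \<in> N" "v \<in> N" by (auto simp: E_iff)
  with 7(5) have False by (auto simp: E_iff)
  then show ?case ..
next
  case (8 u v w) then show ?case by (auto simp: E_iff kind_simps)
next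
  case (9 u v) then show ?case by (auto simp: E_iff)
next
  case (10 u v) then show ?case by blast
qed

text \<open>With all parents of leaves missing, the edges inside \<open>B\<close> join
  \<open>c\<close> to pendant children, and only leaves avoid both ends; these are in
  \<open>B\<close> already.\<close>

lemma prism_convex_pendants:
  "prism_convex V E (insert c (N - p ` L)) (insert c ((N - p ` L) \<union> L))"
proof -
  have parent: "p l \<notin> insert c ((N - p ` L) \<union> L)" if "l \<in> L" for l
    using that by (simp add: kind_simps)
  show ?thesis
    unfolding prism_convex_def
  proof (intro conjI ballI allI impI, goal_cases)
    case 1 show ?case by (auto simp: V_def)
  next
    case 2 show ?case by (auto simp: V_def)
  next
    case (3 u v w)
    then have "u \<in> N - p ` L" "v \<in> N - p ` L" by (auto simp: E_iff)
    with 3(3,5,6) show ?case by (auto simp: E_iff kind_simps)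
  next
    case (4 u v) then show ?case by blast
  next
    case (5 u v) then show ?case by blast
  next
    case (6 u v w x)
    then have "u \<in> N" "v \<in> N" by (auto simp: E_iff)
    with 6(5) have False by (auto simp: E_iff)
    then show ?case ..
  next
    case (7 u v w x)
    then have "u \<in> N" "v \<in> N" by (auto simp: E_iff)
    with 7(5) have False by (auto simp: E_iff)
    then show ?case ..
  next
    case (8 u v w)
    then have "u = c \<or> v = c" using parent[of u] parent[of v] unfolding E_iff by blast
    with 8(7,8) have "w \<notin> N" unfolding E_iff by blast
    with 8(3) show ?case unfolding V_def by blast
  next
    case (9 u v) then show ?case by blast
  next
    case (10 u v)
    then have "u = c \<and> v \<in> N \<or> v = c" using parent[of v] unfolding E_iff by (auto simp: kind_simps)
    with 10(2) show ?case by (auto simp: kind_simps)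
  qed
qed

end

section \<open>Trees of diameter 4\<close>

context bridge_tree
begin

text \<open>\<open>N\<close> and \<open>L\<close> are the levels 1 and 2 around \<open>c\<close>.
  Two vertices at distance 4 must both lie on level 2 and have different parents, which gives
  \<open>two_branches\<close>.\<close>

lemma depth2_structure:
  assumes "finite V" "c \<in> V" and near: "\<And>w. w \<in> V \<Longrightarrow> hops c w \<le> 2"
    and ab: "a \<in> V" "b \<in> V" "hops a b = 4"
  obtains N L p where "depth2_tree c N L p" "V = depth2_tree.V c N L" "A = depth2_tree.E c N L p"
proof -
  define N where "N = {v \<in> V. hops c v = 1}"
  define L where "L = {v \<in> V. hops c v = 2}"
  \<comment> \<open>On level 2 the choice is unique by \<open>hops_parent_unique\<close>.\<close>
  define p where "p l = (SOME y. (y, l) \<in> A \<and> hops c y = 1)" for l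
  have c0: "hops c c = 0" using assms(2) by (simp add: hops_0)
  have p: "(p l, l) \<in> A" "hops c (p l) = 1" if "l \<in> L" for l
  proof -
    from that have l: "l \<in> V" "hops c l = Suc 1" by (auto simp: L_def)
    obtain y where "(y, l) \<in> A" "hops c y = 1" using hops_SucE[OF assms(2) l] .
    then have "(p l, l) \<in> A \<and> hops c (p l) = 1" unfolding p_def by (intro someI) auto
    then show "(p l, l) \<in> A" "hops c (p l) = 1" by auto
  qed
  have p_in: "p l \<in> N" if "l \<in> L" for l using p[OF that] arc_in by (auto simp: N_def)
  have ab_L: "a \<in> L" "b \<in> L"
    using hops_triangle[OF ab(1) assms(2) ab(2)] near[OF ab(1)] near[OF ab(2)] ab hops_sym[of a c]
    by (auto simp: L_def)
  have "p a \<noteq> p b"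
  proof
    assume eq: "p a = p b"
    have pV: "p a \<in> V" using p_in[OF ab_L(1)] by (simp add: N_def)
    have "hops a (p a) \<le> 1" using p(1)[OF ab_L(1)] arcs_sym by (intro hops_le) auto
    moreover have "hops (p a) b \<le> 1" using p(1)[OF ab_L(2)] eq by (intro hops_le) auto
    ultimately show False using hops_triangle[OF ab(1) pV ab(2)] ab(3) by simp
  qed
  moreover have "finite N" "finite L" using assms(1) by (simp_all add: N_def L_def)
  moreover have "c \<notin> N" "c \<notin> L" "N \<inter> L = {}" using c0 by (auto simp: N_def L_def)
  ultimately interpret D: depth2_tree c N L p
    using p_in ab_L by unfold_locales blast+
  have V: "V = D.V"
  proof (intro equalityI subsetI)
    fix v assume v: "v \<in> V"
    have "hops c v = 0 \<or> hops c v = 1 \<or> hops c v = 2" using near[OF v] by linarith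
    with v hops_0[OF assms(2) v] show "v \<in> D.V" unfolding D.V_def unfolding N_def L_def by auto
  next
    fix v assume "v \<in> D.V" then show "v \<in> V" using assms(2) unfolding D.V_def unfolding N_def L_def by blast
  qed
  \<comment> \<open>Oriented away from \<open>c\<close>, an edge joins consecutive levels, and its
    lower end is then \<open>c\<close> or the unique parent.\<close>
  have up: "u = c \<and> v \<in> N \<or> v \<in> L \<and> u = p v" if "(u, v) \<in> A" "hops c u < hops c v" for u v
  proof -
    have uv: "u \<in> V" "v \<in> V" using that(1) arc_in by auto
    have "hops c v = Suc (hops c u)" using hops_arc[OF assms(2) that(1)] that(2) by simp
    with near[OF uv(2)] consider "hops c u = 0" "hops c v = 1" | "hops c u = 1" "hops c v = 2"
      by linarith
    then show ?thesis
    proof cases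
      case 1
      with uv assms(2) show ?thesis by (simp add: N_def hops_0)
    next
      case 2
      then have "v \<in> L" using uv by (simp add: L_def)
      with hops_parent_unique[OF assms(2) that(1) p(1)] p(2)[of v] 2 show ?thesis by simp
    qed
  qed
  have "A = D.E"
  proof (rule set_eqI)
    fix e :: "'a \<times> 'a"
    obtain u v where e: "e = (u, v)" by (cases e)
    have "(u, v) \<in> D.E" if uv: "(u, v) \<in> A"
    proof -
      have "hops c u < hops c v \<or> hops c v < hops c u" using hops_arc_neq[OF assms(2) uv] by linarith
      with up[OF uv] up[OF arcs_sym[OF uv]] show ?thesis unfolding D.E_iff by blast
    qed
    moreover have "(u, v) \<in> A" if "(u, v) \<in> D.E"
    proof -
      have N: "(c, n) \<in> A" if "n \<in> N" for n
      proof -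
        from that have n: "n \<in> V" "hops c n = Suc 0" by (auto simp: N_def)
        obtain x where "(x, n) \<in> A" "hops c x = 0" using hops_SucE[OF assms(2) n] .
        then show ?thesis using arc_in assms(2) hops_0 by metis
      qed
      from that show ?thesis unfolding D.E_iff using N p(1) arcs_sym by blast
    qed
    ultimately show "e \<in> A \<longleftrightarrow> e \<in> D.E" unfolding e by blast
  qed
  with that D.depth2_tree_axioms V show ?thesis by blast
qed

end

section \<open>Recovering the depth-two structure from the diameter\<close>

context pair_graph
begin

lemma depth2_tree_if_diameter_4:
  assumes tree: "undirected_tree G" and diam: "graph_diameter (with_proj G) = 4"
    and c: "c \<in> central_verts (with_proj G)"
  obtains N L p where "depth2_tree c N L p" "pverts G = depth2_tree.V c N L"
    "parcs G = depth2_tree.E c N L p"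
proof -
  interpret T: bridge_tree "pverts G" "parcs G" using tree by (rule bridge_tree_if_undirected_tree)
  have hop: "hop_dist (with_proj G) u v = ereal (real (T.hops u v))"
    if uv: "u \<in> pverts G" "v \<in> pverts G" for u v
  proof (rule antisym)
    from uv have "(u, v) \<in> parcs G ^^ T.hops u v" by (rule T.hops_relpow)
    then obtain q where "awalk u q v" "length q = T.hops u v"
      using relpow_imp_awalk[of u v "T.hops u v"] uv(1) by auto
    then show "hop_dist (with_proj G) u v \<le> ereal (real (T.hops u v))"
      unfolding hop_dist_le_iff by auto
    have "T.hops u v \<le> length q" if "awalk u q v" for q
      using awalk_imp_relpow[OF that] by (intro T.hops_le) simp
    then show "ereal (real (T.hops u v)) \<le> hop_dist (with_proj G) u v"
      unfolding hop_dist_def \<mu>_def by (intro INF_greatest) (auto simp: awalk_cost_def sum_list_triv)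
  qed
  have hop_ecc: "hop_dist (with_proj G) u v \<le> eccentricity (with_proj G) u"
    if "v \<in> pverts G" for u v
    unfolding eccentricity_def using that by (intro SUP_upper) simp
  have ecc_le: "eccentricity (with_proj G) u \<le> ereal (real k)"
    if "u \<in> pverts G" "\<And>v. v \<in> pverts G \<Longrightarrow> T.hops u v \<le> k" for u k
    unfolding eccentricity_def using that by (intro SUP_least) (simp add: hop)
  have le4: "T.hops u v \<le> 4" if "u \<in> pverts G" "v \<in> pverts G" for u v
  proof -
    have "ereal (real (T.hops u v)) \<le> eccentricity (with_proj G) u"
      using hop_ecc[OF that(2), of u] hop[OF that] by simp
    also have "\<dots> \<le> graph_diameter (with_proj G)"
      unfolding graph_diameter_def using that by (intro SUP_upper) simp
    finally show ?thesis using diam by simp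
  qed
  \<comment> \<open>A supremum need not be attained in general; here distances are integers, so
    avoiding 4 would bound them all by 3.\<close>
  have "\<exists>a \<in> pverts G. \<exists>b \<in> pverts G. T.hops a b = 4"
  proof (rule ccontr)
    assume none: "\<not> ?thesis"
    have le3: "T.hops u v \<le> 3" if "u \<in> pverts G" "v \<in> pverts G" for u v
    proof -
      have "T.hops u v \<noteq> 4" using none that by blast
      with le4[OF that] show ?thesis by simp
    qed
    have "graph_diameter (with_proj G) \<le> ereal (real 3)"
      unfolding graph_diameter_def
    proof (rule SUP_least)
      fix u assume "u \<in> verts (with_proj G)"
      then have u: "u \<in> pverts G" by simp
      show "eccentricity (with_proj G) u \<le> ereal (real 3)" using u le3[OF u] by (rule ecc_le)
    qed
    with diam show False by simp
  qed
  then obtain a b where ab: "a \<in> pverts G" "b \<in> pverts G" "T.hops a b = 4" by blast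
  obtain m where m: "m \<in> pverts G" "\<forall>w \<in> pverts G. T.hops m w \<le> 2"
    using T.center_exists[OF ab le4] by blast
  have cV: "c \<in> pverts G" using c by (simp add: central_verts_def)
  \<comment> \<open>Minimality of the eccentricity of \<open>c\<close>, compared with that of
    \<open>m\<close>, gives radius 2 around \<open>c\<close>.\<close>
  have "T.hops c w \<le> 2" if w: "w \<in> pverts G" for w
  proof -
    have "ereal (real (T.hops c w)) \<le> eccentricity (with_proj G) c"
      using hop_ecc[OF w, of c] hop[OF cV w] by simp
    also have "\<dots> \<le> eccentricity (with_proj G) m" using c m by (simp add: central_verts_def)
    also have "\<dots> \<le> ereal (real 2)" using m by (intro ecc_le) blast+
    finally show ?thesis by simp
  qed
  then obtain N L p where "depth2_tree c N L p" "pverts G = depth2_tree.V c N L"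
    "parcs G = depth2_tree.E c N L p"
    using T.depth2_structure[OF pair_finite_verts cV _ ab] by blast
  then show ?thesis by (rule that)
qed

lemma out_degree_eq_card: "out_degree (with_proj G) v = card {w. (v, w) \<in> parcs G}"
proof -
  have "out_arcs (with_proj G) v = Pair v ` {w. (v, w) \<in> parcs G}"
    by (auto simp: out_arcs_def)
  then show ?thesis by (simp add: out_degree_def card_image inj_on_def)
qed

end

section \<open>Degrees, pendant neighbours and the final count\<close>

context depth2_tree
begin

lemma exists_max_branch: "\<exists>y \<in> N. \<forall>z \<in> N. card (lf z) \<le> card (lf y)"
proof -
  have "N \<noteq> {}" using two_branches p_in by blast
  with fin(1) have "Max ((\<lambda>y. card (lf y)) ` N) \<in> (\<lambda>y. card (lf y)) ` N" by (intro Max_in) auto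
  then obtain y where y: "y \<in> N" "Max ((\<lambda>y. card (lf y)) ` N) = card (lf y)" by blast
  have "card (lf z) \<le> card (lf y)" if "z \<in> N" for z
    unfolding y(2)[symmetric] using fin(1) that by (intro Max_ge) auto
  with y(1) show ?thesis by blast
qed

lemma card_lf_less: "card (lf y) < card L"
proof -
  obtain l where "l \<in> L" "p l \<noteq> y" using other_branch .
  then have "lf y \<subset> L" by (auto simp: lf_def)
  with fin(2) show ?thesis by (rule psubset_card_mono)
qed

text \<open>At least two children of \<open>c\<close> carry leaves and so are not pendant.\<close>

lemma card_pendants: "card (N - p ` L) + 2 \<le> card N"
proof -
  obtain l l' where l: "l \<in> L" "l' \<in> L" "p l \<noteq> p l'" using two_branches by blast
  then have "card {p l, p l'} \<le> card (p ` L)" using fin by (intro card_mono) auto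
  moreover have "card {p l, p l'} = 2" using l by simp
  moreover have "card (N - p ` L) = card N - card (p ` L)"
    using fin p_in by (intro card_Diff_subset) auto
  moreover have "card (p ` L) \<le> card N" using fin p_in by (intro card_mono) auto
  ultimately show ?thesis by simp
qed

context
  fixes G :: "'a pair_pre_digraph"
  assumes G: "pair_graph G" and V: "pverts G = V" and E: "parcs G = E"
begin

interpretation pair_graph G by (rule G)

lemma out_degrees:
  "out_degree (with_proj G) c = card N"
  "y \<in> N \<Longrightarrow> out_degree (with_proj G) y = 1 + card (lf y)"
  "l \<in> L \<Longrightarrow> out_degree (with_proj G) l = 1"
  using c_notin_lf by (simp_all add: out_degree_eq_card E nbrs_center nbrs_child nbrs_leaf)

lemma max_degree_off_center:
  assumes "y \<in> N" "\<And>z. z \<in> N \<Longrightarrow> card (lf z) \<le> card (lf y)"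
  shows "max_degree_on (with_proj G) (pverts G - {c}) = 1 + card (lf y)"
  unfolding max_degree_on_def
proof (rule Max_eqI)
  show "finite (out_degree (with_proj G) ` (pverts G - {c}))" by simp
  show "d \<le> 1 + card (lf y)" if "d \<in> out_degree (with_proj G) ` (pverts G - {c})" for d
  proof -
    from that obtain v where v: "d = out_degree (with_proj G) v" "v \<in> N \<or> v \<in> L"
      by (auto simp: V V_def)
    from v(2) show ?thesis
    proof
      assume "v \<in> N" with assms(2)[of v] v(1) show ?thesis by (simp add: out_degrees)
    next
      assume "v \<in> L" with v(1) show ?thesis by (simp add: out_degrees)
    qed
  qed
  have "y \<in> pverts G - {c}" using assms(1) by (auto simp: V V_def kind_simps)
  then show "1 + card (lf y) \<in> out_degree (with_proj G) ` (pverts G - {c})"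
    using out_degrees(2)[OF assms(1)] by (metis imageI)
qed

lemma max_degree_eq:
  "max_degree (with_proj G) = max (card N) (max_degree_on (with_proj G) (pverts G - {c}))"
proof -
  have "pverts G = insert c (pverts G - {c})" by (auto simp: V V_def)
  then have "out_degree (with_proj G) ` pverts G =
      insert (card N) (out_degree (with_proj G) ` (pverts G - {c}))"
    by (metis image_insert out_degrees(1))
  moreover have "pverts G - {c} \<noteq> {}"
  proof -
    obtain l where "l \<in> L" using two_branches by blast
    then show ?thesis by (auto simp: V V_def kind_simps)
  qed
  ultimately show ?thesis unfolding max_degree_on_def with_proj_simps by (simp add: Max_insert)
qed

lemma num_pendant_nbrs_center: "num_pendant_nbrs (with_proj G) c = card (N - p ` L)"
proof -
  have "{y \<in> pverts G. (c, y) \<in> parcs G \<and> out_degree (with_proj G) y = 1} = N - p ` L"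
  proof (intro equalityI subsetI)
    fix y assume "y \<in> {y \<in> pverts G. (c, y) \<in> parcs G \<and> out_degree (with_proj G) y = 1}"
    then have y: "y \<in> N" "out_degree (with_proj G) y = 1" using nbrs_center by (auto simp: E)
    then have "lf y = {}" by (simp add: out_degrees)
    with y show "y \<in> N - p ` L" by (auto simp: lf_def)
  next
    fix y assume y: "y \<in> N - p ` L"
    then have "lf y = {}" by (auto simp: lf_def)
    with y show "y \<in> {y \<in> pverts G. (c, y) \<in> parcs G \<and> out_degree (with_proj G) y = 1}"
      using nbrs_center by (auto simp: V V_def E out_degrees)
  qed
  then show ?thesis by (simp add: num_pendant_nbrs_def)
qed

text \<open>The lower bounds come from the three explicit pairs. The upper bound has
  \<open>max (card N) D'\<close> where the second lower bound has \<open>card N\<close>; they differ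
  only for \<open>D' > card N\<close>, where the first value dominates.\<close>

lemma convexity_number_prism:
  assumes y: "y \<in> N" "\<And>z. z \<in> N \<Longrightarrow> card (lf z) \<le> card (lf y)"
  defines "D' \<equiv> 1 + card (lf y)"
  shows "convexity_number (with_proj (complementary_prism G)) \<ge> card V + D' - 1"
    and "convexity_number (with_proj (complementary_prism G)) \<ge> 2 * card N + 1"
    and "convexity_number (with_proj (complementary_prism G)) \<ge> 2 + 2 * card (N - p ` L) + card L"
    and "convexity_number (with_proj (complementary_prism G)) \<le>
      max (card V + D' - 1) (max (2 * max (card N) D' + 1) (2 + 2 * card (N - p ` L) + card L))"
proof -
  let ?cn = "convexity_number (with_proj (complementary_prism G))"
  have lower: "card A + card B \<le> ?cn" if "prism_convex V E A B" "A \<noteq> V \<or> B \<noteq> V" for A B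
    using convexity_number_prism_ge[of A B] that common_nonneighbour by (simp add: V E)
  have cV: "c \<in> V" by (simp add: V_def)
  have "y \<notin> lf y" using y(1) by (auto simp: lf_def kind_simps)
  then have "card (insert y (lf y)) = D'" by (simp add: D'_def)
  moreover have "card (V - {c}) = card V - 1" using cV by simp
  moreover have "card (insert y (lf y)) + card (V - {c}) \<le> ?cn"
    using cV by (intro lower prism_convex_branch y) auto
  ultimately show "?cn \<ge> card V + D' - 1" using card_V by simp
  have "card (insert c N) + card N \<le> ?cn"
    using cV disj by (intro lower prism_convex_center_star) auto
  then show "?cn \<ge> 2 * card N + 1" using fin disj by simp
  let ?P = "N - p ` L"
  obtain l where "l \<in> L" using two_branches by blast
  then have "l \<in> V" "l \<notin> insert c ?P" by (auto simp: V_def kind_simps)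
  then have "card (insert c ?P) + card (insert c (?P \<union> L)) \<le> ?cn"
    by (intro lower prism_convex_pendants) blast
  moreover have "card (insert c ?P) = 1 + card ?P" using fin disj by simp
  moreover have "card (insert c (?P \<union> L)) = 1 + card ?P + card L"
    using fin disj by (subst card_insert_disjoint) (auto intro!: card_Un_disjoint)
  ultimately show "?cn \<ge> 2 + 2 * card ?P + card L" by simp
  show "?cn \<le> max (card V + D' - 1) (max (2 * max (card N) D' + 1) (2 + 2 * card ?P + card L))"
  proof (rule convexity_number_prism_le)
    show "pverts G \<noteq> {}" using cV V by blast
    fix A B assume "prism_convex (pverts G) (parcs G) A B" "A \<noteq> pverts G \<or> B \<noteq> pverts G"
    then have "prism_convex V E A B" "A \<noteq> V \<or> B \<noteq> V" by (simp_all add: V E)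
    from prism_convex_card_le[OF this, of D' "max (card N) D'"] y(2)
    show "card A + card B \<le>
        max (card V + D' - 1) (max (2 * max (card N) D' + 1) (2 + 2 * card ?P + card L))"
      by (auto simp: D'_def)
  qed
qed

end

end

theorem theorem3p10:
  fixes T :: "'a pair_pre_digraph" and c :: 'a
  assumes "undirected_tree T"
    and "graph_diameter (with_proj T) = 4"
    and "c \<in> central_verts (with_proj T)"
  shows "int (convexity_number (with_proj (complementary_prism T))) =
    (let n = int (card (pverts T));
         \<Delta> = int (max_degree (with_proj T));
         \<Delta>' = int (max_degree_on (with_proj T) (pverts T - {c}));
         e = int (num_pendant_nbrs (with_proj T) c)
     in if int (out_degree (with_proj T) c) < \<Delta> then n + \<Delta> - 1
        else Max {n + \<Delta>' - 1, 2 * \<Delta> + 1, n + 2 * e - \<Delta> + 1})"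
proof -
  have G: "pair_graph T" using assms(1) by (simp add: undirected_tree_def)
  obtain N L p where D: "depth2_tree c N L p" and V: "pverts T = depth2_tree.V c N L"
    and E: "parcs T = depth2_tree.E c N L p"
    using pair_graph.depth2_tree_if_diameter_4[OF G assms] .
  interpret depth2_tree c N L p by (rule D)
  obtain y where y: "y \<in> N" "\<And>z. z \<in> N \<Longrightarrow> card (lf z) \<le> card (lf y)"
    using exists_max_branch by blast
  define D' where "D' = 1 + card (lf y)"
  note bounds = convexity_number_prism[OF G V E y, folded D'_def]
  have D'_eq: "max_degree_on (with_proj T) (pverts T - {c}) = D'"
    unfolding D'_def by (rule max_degree_off_center[OF G V E y])
  have "max_degree_on (with_proj T) (pverts T) = max (card N) D'"
    using max_degree_eq[OF G V E] D'_eq by simp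
  note degs = D'_eq this out_degrees(1)[OF G V E]
    num_pendant_nbrs_center[OF G V E]
  have arith: "D' \<le> card L" "D' \<ge> 1" using card_lf_less[of y] by (simp_all add: D'_def)
  have card_eq: "card (pverts T) = card V" using V by simp
  let ?cn = "convexity_number (with_proj (complementary_prism T))"
  show ?thesis
  proof (cases "card N < D'")
    case True
    \<comment> \<open>The first value is \<open>card N + card L + D'\<close>. It is at least
      \<open>2 * D' + 1\<close> since \<open>D' \<le> card L\<close>, and it exceeds the third since
      the pendant children number at most \<open>card N - 2\<close> and
      \<open>card N < D'\<close>.\<close>
    then have "?cn = card V + D' - 1" using bounds(1,4) card_V card_pendants arith by simp
    with True show ?thesis using arith by (simp add: Let_def degs card_eq)
  next
    case False
    \<comment> \<open>Now \<open>card N\<close> is the maximum degree, so each term of the upper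
      bound is attained.\<close>
    then have "?cn = max (card V + D' - 1)
        (max (2 * card N + 1) (2 + 2 * card (N - p ` L) + card L))"
      using bounds by simp
    with False show ?thesis using arith card_V by (simp add: Let_def degs card_eq max_def)
  qed
qed

end
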